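(* Let $\Phi$ be a $d\times K$ dictionary with unit-norm atoms $\varphi_1,\dots,\varphi_K$. Assume that the support $\Lambda$ of $x$, for a signal $y=\Phi x$ normalised to have $\|y\|_2=1$, could be recovered by thresholding with a margin $\varepsilon>0$, i.e. $$\min_{i\in\Lambda}|\langle y,\varphi_i\rangle|>\max_{k\in\overline{\Lambda}}|\langle y,\varphi_k\rangle|+\varepsilon .$$ Let $A$ be an $n\times d$ random matrix whose entries are either independent $\mathcal{N}(0,n^{-1})$ random variables or independent $\pm1/\sqrt n$ Bernoulli random variables. Then, for $t>0$, with probability exceeding $1-e^{-t}$ the support and thus the signal can be reconstructed via thresholding from the $n$-dimensional measurement vector $s=Ay=A\Phi x$ as long as $$n\ge C(\varepsilon)\left(\log(2K)+t\right),$$ where $C(\varepsilon)=4C_1\varepsilon^{-2}+2C_2\varepsilon^{-1}$ with $C_1=\frac{4e}{\sqrt{6\pi}}\approx 2.5044$ and $C_2=e\sqrt2\approx 3.8442$. In particular, $$C(\varepsilon)\le C_3\varepsilon^{-2}$$ with $C_3\le 4C_1+2C_2\le 17.71$.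
   Context: A dictionary is a deterministic $d\times K$ matrix with columns (atoms) $\varphi_1,\dots,\varphi_K$; $\overline{\Lambda}=\{1,\dots,K\}\setminus\Lambda$. Thresholding, applied to $s=\Psi x$ with $\Psi=A\Phi$ having columns $\psi_j=A\varphi_j$ and with sparsity $S=|\Lambda|$, finds the set $\Lambda'$ of indices corresponding to the $S$ largest values of $|\langle s,\psi_j\rangle|$ and outputs the coefficient vector $\Psi_{\Lambda'}^\dagger s$ on $\Lambda'$, where $\Psi_{\Lambda'}$ is the submatrix of columns indexed by $\Lambda'$ and $\dagger$ denotes the pseudo-inverse. The signal is fixed (independent of $A$). $\mathcal{N}(0,n^{-1})$ is the centered Gaussian distribution with variance $1/n$; a $\pm1/\sqrt n$ Bernoulli variable takes each sign with probability $1/2$. $\log$ is the natural logarithm.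
   Formalization: The support is recovered as claimed; the signal (coefficients) is claimed only when A is injective on the span of the support atoms (Ψ_Λ is injective), since otherwise, e.g. if n is smaller than S, the pseudo-inverse output need not give the signal. *)

theory Defs
  imports "HOL-Probability.Probability"
begin

definition penrose :: "real^'k^'n \<Rightarrow> real^'n^'k \<Rightarrow> bool" where
  "penrose B X \<longleftrightarrow> B ** X ** B = B \<and> X ** B ** X = X \<and>
     transpose (B ** X) = B ** X \<and> transpose (X ** B) = X ** B"

definition pseudo_inverse :: "real^'k^'n \<Rightarrow> real^'n^'k" where
  "pseudo_inverse B = (THE X. penrose B X)"

lemma penrose_unique:
  assumes "penrose B X" "penrose B Y"
  shows "X = Y"
proof -
  have X: "B ** X ** B = B" "X ** B ** X = X"
    "transpose (B ** X) = B ** X" "transpose (X ** B) = X ** B"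
    using assms(1) by (auto simp: penrose_def)
  have Y: "B ** Y ** B = B" "Y ** B ** Y = Y"
    "transpose (B ** Y) = B ** Y" "transpose (Y ** B) = Y ** B"
    using assms(2) by (auto simp: penrose_def)
  have 1: "B ** X = B ** Y"
  proof -
    have "B ** X = transpose ((B ** Y) ** (B ** X))"
      by (metis X(3) Y(1) matrix_mul_assoc)
    also have "\<dots> = (B ** X) ** (B ** Y)"
      by (simp only: matrix_transpose_mul[of "B ** Y" "B ** X"] X(3) Y(3))
    also have "\<dots> = B ** Y" by (metis X(1) matrix_mul_assoc)
    finally show ?thesis .
  qed
  have 2: "X ** B = Y ** B"
  proof -
    have "X ** B = transpose ((X ** B) ** (Y ** B))"
      by (metis X(4) Y(1) matrix_mul_assoc)
    also have "\<dots> = (Y ** B) ** (X ** B)"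
      by (simp only: matrix_transpose_mul[of "X ** B" "Y ** B"] X(4) Y(4))
    also have "\<dots> = Y ** B" by (metis X(1) matrix_mul_assoc)
    finally show ?thesis .
  qed
  show ?thesis by (metis 1 2 X(2) Y(2) matrix_mul_assoc)
qed

lemma symmetric_matrixI:
  fixes P :: "real^'k^'k"
  assumes "\<And>v w. (P *v v) \<bullet> w = v \<bullet> (P *v w)"
  shows "transpose P = P"
proof -
  have "transpose P *v w = P *v w" for w
  proof (rule vector_eq_rdot[THEN iffD1], intro allI)
    fix v :: "real^'k"
    show "(transpose P *v w) \<bullet> v = (P *v w) \<bullet> v"
      using assms[of v w] by (metis dot_lmul_matrix inner_commute transpose_matrix_vector)
  qed
  then show ?thesis by (simp add: matrix_eq)
qed

lemma penrose_exists: "\<exists>X. penrose (B :: real^'k^'n) X"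
proof -
  define T where "T = transpose B"
  define U where "U = range (\<lambda>z. T *v z)"
  define h where "h = (\<lambda>u. T *v (B *v u))"
  have adj: "(T *v z) \<bullet> v = z \<bullet> (B *v v)" for z v
    unfolding T_def by (metis dot_lmul_matrix transpose_matrix_vector)
  have subU: "subspace U" unfolding U_def
    by (intro linear_subspace_image) (auto simp: matrix_vector_mul_linear)
  have linh: "linear h" unfolding h_def
    by (simp add: matrix_vector_mul_assoc matrix_vector_mul_linear)
  have inj: "inj_on h U"
  proof (subst linear_inj_on_iff_eq_0[OF linh])
    show "subspace U" by (fact subU)
    show "\<forall>v\<in>U. h v = 0 \<longrightarrow> v = 0"
    proof (intro ballI impI)
      fix v assume v: "v \<in> U" "h v = 0"
      have "(B *v v) \<bullet> (B *v v) = h v \<bullet> v" by (simp only: h_def adj)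
      then have Bv: "B *v v = 0" using v by simp
      obtain z where "v = T *v z" using v by (auto simp: U_def)
      then have "v \<bullet> v = 0" using adj[of z v] Bv by (simp only: inner_zero_right)
      then show "v = 0" by simp
    qed
  qed
  obtain g where g: "range g \<subseteq> U" "linear g" "\<And>u. u \<in> U \<Longrightarrow> g (h u) = u"
    using linear_exists_left_inverse_on[OF linh subU inj] by auto
  define X where "X = matrix g ** T"
  have Xv: "X *v s = g (T *v s)" for s
    
    using fun_cong[OF matrix_vector_mul(2)[OF g(2)], of "T *v s"]
    by (simp only: X_def matrix_vector_mul_assoc[symmetric])
  have decU: "\<exists>u w. v = u + w \<and> u \<in> U \<and> (\<forall>u'\<in>U. u' \<bullet> w = 0) \<and> B *v w = 0" for v
  proof -
    obtain u w where uw: "u \<in> span U" "\<And>u'. u' \<in> span U \<Longrightarrow> orthogonal w u'" "v = u + w"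
      using orthogonal_subspace_decomp_exists[of U v] by blast
    have sp: "span U = U" using subU by (simp add: span_eq_iff)
    have o: "u' \<bullet> w = 0" if "u' \<in> U" for u'
      using uw(2)[of u'] that sp by (simp add: orthogonal_def inner_commute)
    have "(B *v w) \<bullet> (B *v w) = (T *v (B *v w)) \<bullet> w" by (simp only: adj)
    also have "\<dots> = 0" by (intro o) (auto simp: U_def)
    finally show ?thesis using uw o sp by auto
  qed
  have decR: "\<exists>v r. s = B *v v + r \<and> (\<forall>v'. (B *v v') \<bullet> r = 0)" for s
  proof -
    let ?R = "range (\<lambda>v. B *v v)"
    have sp: "span ?R = ?R"
      by (simp add: span_eq_iff linear_subspace_image matrix_vector_mul_linear)
    obtain u r where ur: "u \<in> span ?R" "\<And>u'. u' \<in> span ?R \<Longrightarrow> orthogonal r u'" "s = u + r"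
      using orthogonal_subspace_decomp_exists[of ?R s] by blast
    then obtain v where "u = B *v v" using sp by auto
    moreover have "(B *v v') \<bullet> r = 0" for v'
      using ur(2)[of "B *v v'"] sp by (auto simp: orthogonal_def inner_commute)
    ultimately show ?thesis using ur(3) by blast
  qed
  have XB: "X *v (B *v (u + w)) = u" if "u \<in> U" "B *v w = 0" for u w
    using that g(3)[of u] by (simp add: Xv h_def matrix_vector_right_distrib)
  have XU: "X *v s \<in> U" for s using g(1) by (auto simp: Xv)
  have BXB: "B *v (X *v (B *v v)) = B *v v" for v
  proof -
    obtain u w where "v = u + w" "u \<in> U" "B *v w = 0" using decU by blast
    then show ?thesis using XB[of u w] by (simp add: matrix_vector_right_distrib)
  qed
  have BX: "B *v (X *v (B *v v + r)) = B *v v" if "\<forall>v'. (B *v v') \<bullet> r = 0" for v r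
  proof -
    have "(T *v r) \<bullet> (T *v r) = 0"
      using that by (simp only: adj inner_commute[of r])
    then have "X *v r = 0" using g(2) by (simp add: Xv linear_0)
    then show ?thesis by (simp add: matrix_vector_right_distrib BXB)
  qed
  have "penrose B X" unfolding penrose_def
  proof (intro conjI)
    show "B ** X ** B = B"
      by (simp add: matrix_eq BXB flip: matrix_vector_mul_assoc)
    show "X ** B ** X = X"
      using XB[OF XU, of 0] by (simp add: matrix_eq flip: matrix_vector_mul_assoc)
    show "transpose (B ** X) = B ** X"
    proof (rule symmetric_matrixI)
      fix s s' :: "real^'n"
      obtain v r where s: "s = B *v v + r" "\<forall>v'. (B *v v') \<bullet> r = 0" using decR by blast
      obtain v' r' where s': "s' = B *v v' + r'" "\<forall>v''. (B *v v'') \<bullet> r' = 0" using decR by blast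
      show "(B ** X *v s) \<bullet> s' = s \<bullet> (B ** X *v s')"
        using s s' BX[OF s(2)] BX[OF s'(2)]
        by (simp add: inner_add_left inner_add_right inner_commute[of r] flip: matrix_vector_mul_assoc)
    qed
    show "transpose (X ** B) = X ** B"
    proof (rule symmetric_matrixI)
      fix v v' :: "real^'k"
      obtain u w where v: "v = u + w" "u \<in> U" "\<forall>u'\<in>U. u' \<bullet> w = 0" "B *v w = 0"
        using decU by blast
      obtain u' w' where v': "v' = u' + w'" "u' \<in> U" "\<forall>u\<in>U. u \<bullet> w' = 0" "B *v w' = 0"
        using decU by blast
      show "(X ** B *v v) \<bullet> v' = v \<bullet> (X ** B *v v')"
        using v v' XB[OF v(2) v(4)] XB[OF v'(2) v'(4)]
        by (simp add: inner_add_left inner_add_right inner_commute[of w] flip: matrix_vector_mul_assoc)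
    qed
  qed
  then show ?thesis ..
qed

lemma penrose_pseudo_inverse: "penrose B (pseudo_inverse B)"
  unfolding pseudo_inverse_def
  by (rule theI') (metis penrose_exists penrose_unique)

definition support :: "real^'k \<Rightarrow> 'k set" where
  "support x = {j. x $ j \<noteq> 0}"

text \<open>The submatrix of the columns in \<open>L\<close> keeps its type: the other columns are set to zero.
  Correspondingly the rows of its pseudo-inverse outside \<open>L\<close> vanish, so a coefficient vector on
  \<open>L\<close> appears extended by zero.\<close>

definition restrict_columns :: "'k set \<Rightarrow> real^'k^'n \<Rightarrow> real^'k^'n" where
  "restrict_columns L B = (\<chi> i j. if j \<in> L then B $ i $ j else 0)"

text \<open>Ties are not broken: all index sets of the \<open>S\<close> largest correlations are collected, each
  paired with its coefficient vector.\<close>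

definition thresholding_supports :: "real^'k^'n \<Rightarrow> nat \<Rightarrow> real^'n \<Rightarrow> 'k set set" where
  "thresholding_supports \<Psi> S s =
     {L. card L = S \<and> (\<forall>i\<in>L. \<forall>k\<in>-L. \<bar>s \<bullet> column k \<Psi>\<bar> \<le> \<bar>s \<bullet> column i \<Psi>\<bar>)}"

definition thresholding :: "real^'k^'n \<Rightarrow> nat \<Rightarrow> real^'n \<Rightarrow> ('k set \<times> (real^'k)) set" where
  "thresholding \<Psi> S s =
     (\<lambda>L. (L, pseudo_inverse (restrict_columns L \<Psi>) *v s)) ` thresholding_supports \<Psi> S s"

text \<open>The inserted \<open>0\<close> only matters when \<open>L\<close> contains all indices: the maximum of the
  (nonnegative) correlations over the empty set is then \<open>0\<close>.\<close>

definition thresholding_margin :: "real^'k^'d \<Rightarrow> real^'d \<Rightarrow> 'k set \<Rightarrow> real \<Rightarrow> bool" where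
  "thresholding_margin \<Phi> y L \<epsilon> \<longleftrightarrow>
     Min ((\<lambda>i. \<bar>y \<bullet> column i \<Phi>\<bar>) ` L)
       > Max (insert 0 ((\<lambda>k. \<bar>y \<bullet> column k \<Phi>\<bar>) ` (- L))) + \<epsilon>"

text \<open>Reconstruction of the support: it is the only possible outcome of thresholding.
  Recovering the support does not by itself make the submatrix of \<open>A ** \<Phi>\<close> on the support
  injective (it may have more columns than rows), and without injectivity no decoder can
  determine the coefficients. The signal and its coefficients are therefore
  required to be returned whenever the measurements determine them on that support.\<close>

definition reconstructed_by_thresholding :: "real^'k^'d \<Rightarrow> real^'k \<Rightarrow> real^'d^'n \<Rightarrow> bool" where
  "reconstructed_by_thresholding \<Phi> x A \<longleftrightarrow>
     (let V = {z. support z \<subseteq> support x} in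
       \<exists>x'. thresholding (A ** \<Phi>) (card (support x)) (A *v (\<Phi> *v x)) = {(support x, x')} \<and>
         (inj_on (\<lambda>v. A *v v) ((\<lambda>z. \<Phi> *v z) ` V) \<longrightarrow> \<Phi> *v x' = \<Phi> *v x) \<and>
         (inj_on (\<lambda>z. (A ** \<Phi>) *v z) V \<longrightarrow> x' = x))"

definition gaussian_matrix :: "'w measure \<Rightarrow> ('w \<Rightarrow> real^'d^'n) \<Rightarrow> bool" where
  "gaussian_matrix M A \<longleftrightarrow>
     prob_space.indep_vars M (\<lambda>_. borel) (\<lambda>(i, j) \<omega>. A \<omega> $ i $ j) UNIV \<and>
     (\<forall>i j. distributed M lborel (\<lambda>\<omega>. A \<omega> $ i $ j)
        (\<lambda>u. ennreal (normal_density 0 (1 / sqrt (real CARD('n))) u)))"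

definition bernoulli_matrix :: "'w measure \<Rightarrow> ('w \<Rightarrow> real^'d^'n) \<Rightarrow> bool" where
  "bernoulli_matrix M A \<longleftrightarrow>
     prob_space.indep_vars M (\<lambda>_. borel) (\<lambda>(i, j) \<omega>. A \<omega> $ i $ j) UNIV \<and>
     (\<forall>i j. measure M {\<omega> \<in> space M. A \<omega> $ i $ j = 1 / sqrt (real CARD('n))} = 1 / 2 \<and>
            measure M {\<omega> \<in> space M. A \<omega> $ i $ j = - 1 / sqrt (real CARD('n))} = 1 / 2)"

definition C1 :: real where "C1 = 4 * exp 1 / sqrt (6 * pi)"

definition C2 :: real where "C2 = exp 1 * sqrt 2"

definition C3 :: real where "C3 = 4 * C1 + 2 * C2"

definition C_margin :: "real \<Rightarrow> real" where
  "C_margin \<epsilon> = 4 * C1 / \<epsilon>\<^sup>2 + 2 * C2 / \<epsilon>"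

end

theory Submission
  imports Defs
begin

text \<open>Write each atom as \<open>\<phi>\<^sub>j = c\<^sub>j y + w\<^sub>j\<close> with \<open>c\<^sub>j = \<langle>y, \<phi>\<^sub>j\<rangle>\<close> and \<open>w\<^sub>j\<close> orthogonal to \<open>y\<close>, so that
  \<open>\<langle>Ay, A\<phi>\<^sub>j\<rangle> = c\<^sub>j \<parallel>Ay\<parallel>\<^sup>2 + \<langle>Ay, Aw\<^sub>j\<rangle>\<close>. The first summand multiplies all correlations by the same factor
  and hence keeps their order. With \<open>\<delta> = \<epsilon>/2\<close>, the margin survives as soon as
  \<open>\<bar>\<langle>Ay, Aw\<^sub>j\<rangle>\<bar> < \<delta> \<parallel>Ay\<parallel>\<^sup>2\<close> for all \<open>j\<close> (\<open>separation_of_measured_correlations\<close>). Measuring the deviation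
  against \<open>\<parallel>Ay\<parallel>\<^sup>2\<close> is what gives the constants: the fluctuation of \<open>\<langle>Ay, A\<phi>\<^sub>j\<rangle>\<close> about \<open>c\<^sub>j\<close> has variance up
  to \<open>2/n\<close>, for instance for \<open>\<phi>\<^sub>j = y\<close> and Gaussian entries, and a Bernstein bound with that
  variance would require a leading constant \<open>4\<close> in place of \<open>C\<^sub>1\<close>, which is about \<open>2.5\<close>. The product
  \<open>\<langle>Ay, Aw\<^sub>j\<rangle>\<close> only has variance at most \<open>1/n\<close>.

  There are \<open>2K\<close> events \<open>\<delta> \<parallel>Ay\<parallel>\<^sup>2 \<le> \<langle>Ay, \<plusminus>Aw\<^sub>j\<rangle>\<close> to exclude, two for each atom. Up to normalisation such an
  event says that a sum over the independent rows of \<open>X (W - \<delta> X)\<close> is nonnegative, where \<open>X\<close> and \<open>W\<close>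
  are the inner products of a row with \<open>y\<close> and \<open>\<plusminus>w\<^sub>j\<close>. Chernoff's method reduces this to bounding
  \<open>E exp (\<beta> X (W - \<delta> X))\<close> for one row by \<open>exp (- \<theta>)\<close> with a rate \<open>\<theta> > \<delta>\<^sup>2 / (C\<^sub>1 + C\<^sub>2 \<delta>) = 1 / C(\<epsilon>)\<close>; the
  strict inequality between the rates makes the final probability bound strict. The choice
  \<open>\<beta> = \<delta> / (1 + 3 \<delta>)\<close> serves both distributions.

  For Gaussian entries the expectation is computed exactly, by integrating out one coordinate
  at a time (\<open>gaussian_quadratic_mgf\<close>). For signs, \<open>\<beta> X (W - \<delta> X) + \<beta> \<delta>\<close> is a quadratic form with zero
  diagonal, whose Frobenius norm \<open>b\<close> is at most \<open>\<beta> (1/2 + \<delta>\<^sup>2)\<^sup>1\<^sup>/\<^sup>2\<close>. Summation by parts over single sign flips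
  yields a differential inequality for the moment generating function of such a form, and
  integrating it bounds the exponential moment by \<open>exp (- b) (1 - 2 b)\<^sup>-\<^sup>1\<^sup>/\<^sup>2\<close>
  (\<open>rademacher_chaos_mgf\<close>).\<close>

section \<open>Exponential moments of quadratic forms in random signs\<close>

definition sign_vectors :: "(real^'d) set" where
  "sign_vectors = {\<sigma>. \<forall>j. \<sigma> $ j = 1 \<or> \<sigma> $ j = -1}"

definition flip :: "'d \<Rightarrow> real^'d \<Rightarrow> real^'d" where
  "flip j \<sigma> = \<sigma> - (2 * \<sigma> $ j) *\<^sub>R axis j 1"

lemma finite_sign_vectors: "finite (sign_vectors :: (real^'d) set)"
proof -
  have "(sign_vectors :: (real^'d) set) \<subseteq> vec_lambda ` PiE UNIV (\<lambda>_. {1, -1})"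
  proof
    fix \<sigma> :: "real^'d" assume "\<sigma> \<in> sign_vectors"
    then have "vec_nth \<sigma> \<in> PiE UNIV (\<lambda>_. {1, -1})" by (auto simp: sign_vectors_def)
    then show "\<sigma> \<in> vec_lambda ` PiE UNIV (\<lambda>_. {1, -1})" by (metis imageI vec_nth_inverse)
  qed
  then show ?thesis by (rule finite_subset) (intro finite_imageI finite_PiE, auto)
qed

lemma flip_nth: "flip j \<sigma> $ k = (if k = j then - \<sigma> $ j else \<sigma> $ k)"
  by (auto simp: flip_def axis_def)

lemma sum_flip:
  "(\<Sum>\<sigma>\<in>sign_vectors. f (flip j \<sigma>)) = (\<Sum>\<sigma>\<in>sign_vectors. f \<sigma>)"
  by (rule sum.reindex_bij_witness[of _ "flip j" "flip j"])
     (auto simp: sign_vectors_def flip_nth vec_eq_iff)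

lemma power2_norm_vec: "(norm v)\<^sup>2 = (\<Sum>j\<in>UNIV. (v $ j)\<^sup>2)" for v :: "real^'d"
  by (simp add: norm_vec_def L2_set_def sum_nonneg)

definition chaos :: "real^'d^'d \<Rightarrow> real^'d \<Rightarrow> real" where
  "chaos B \<sigma> = \<sigma> \<bullet> (B *v \<sigma>)"

lemma symmetric_inner:
  fixes B :: "real^'d^'d"
  assumes "transpose B = B"
  shows "(B *v u) \<bullet> v = u \<bullet> (B *v v)"
  by (metis assms dot_lmul_matrix transpose_matrix_vector)

lemma matrix_vector_axis: "(B *v axis j 1) = column j (B :: real^'d^'n)"
  by (simp add: matrix_vector_mult_basis)

text \<open>With a vanishing diagonal the \<open>j\<close>-th component of \<open>B \<sigma>\<close> does not involve \<open>\<sigma>\<^sub>j\<close>, so the form is affine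
  in each single sign.\<close>

lemma chaos_flip:
  fixes B :: "real^'d^'d"
  assumes sym: "transpose B = B" and diag: "B $ j $ j = 0"
  shows "chaos B (flip j \<sigma>) = chaos B \<sigma> - 4 * \<sigma> $ j * (B *v \<sigma>) $ j"
proof -
  have 1: "axis j 1 \<bullet> (B *v \<sigma>) = (B *v \<sigma>) $ j" by (simp add: inner_axis' )
  have 2: "\<sigma> \<bullet> (B *v axis j 1) = (B *v \<sigma>) $ j"
    using symmetric_inner[OF sym, of \<sigma> "axis j 1"] by (simp add: inner_axis)
  have 3: "axis j 1 \<bullet> (B *v axis j 1) = 0"
    by (simp add: matrix_vector_axis inner_axis' column_def diag)
  show ?thesis
    unfolding chaos_def flip_def
    by (simp add: matrix_vector_mult_diff_distrib matrix_vector_mult_scaleR inner_diff_left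
        inner_diff_right 1 2 3)
qed

lemma flip_apply_nth:
  fixes B :: "real^'d^'d"
  shows "(B *v flip j \<sigma>) $ k = (B *v \<sigma>) $ k - 2 * \<sigma> $ j * B $ k $ j"
  unfolding flip_def
  by (simp add: matrix_vector_mult_diff_distrib matrix_vector_mult_scaleR matrix_vector_axis column_def)

lemma tanh_exp_balance:
  fixes x :: real
  shows "(1 - tanh x) * exp x = (1 + tanh x) * exp (- x)"
proof -
  have "cosh x \<noteq> 0" by simp
  then have "tanh x * cosh x = sinh x" by (simp add: tanh_def)
  then show ?thesis
    by (simp add: sinh_def cosh_def algebra_simps)
qed

text \<open>The analogue for signs of Gaussian integration by parts. Under the tilted measure with weights
  \<open>exp (s \<cdot> chaos B \<sigma>)\<close> and given the other signs, \<open>\<sigma>\<^sub>j\<close> has mean \<open>tanh (2 s (B \<sigma>)\<^sub>j)\<close>; a factor that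
  does not depend on \<open>\<sigma>\<^sub>j\<close> is constant under this conditioning. The proof pairs each vector
  with its flip.\<close>

lemma sum_by_parts_sign:
  fixes B :: "real^'d^'d"
  assumes sym: "transpose B = B" and diag: "B $ j $ j = 0"
    and inv: "\<And>\<sigma>. f (flip j \<sigma>) = f \<sigma>"
  shows "(\<Sum>\<sigma>\<in>sign_vectors. \<sigma> $ j * f \<sigma> * exp (s * chaos B \<sigma>)) =
         (\<Sum>\<sigma>\<in>sign_vectors. tanh (2 * s * (B *v \<sigma>) $ j) * f \<sigma> * exp (s * chaos B \<sigma>))"
proof -
  define t where "t \<sigma> = tanh (2 * s * (B *v \<sigma>) $ j)" for \<sigma>
  define F where "F \<sigma> = (\<sigma> $ j - t \<sigma>) * f \<sigma> * exp (s * chaos B \<sigma>)" for \<sigma>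
  have "F \<sigma> + F (flip j \<sigma>) = 0" if "\<sigma> \<in> sign_vectors" for \<sigma>
  proof -
    define x where "x = 2 * s * (B *v \<sigma>) $ j"
    have tf: "t (flip j \<sigma>) = t \<sigma>" by (simp add: t_def flip_apply_nth diag)
    have tx: "t \<sigma> = tanh x" by (simp add: t_def x_def)
    define r where "r = s * chaos B \<sigma> - \<sigma> $ j * x"
    have e1: "exp (s * chaos B \<sigma>) = exp r * exp (\<sigma> $ j * x)"
      by (simp add: r_def flip: exp_add)
    have e2: "exp (s * chaos B (flip j \<sigma>)) = exp r * exp (- (\<sigma> $ j * x))"
      by (simp add: r_def x_def chaos_flip[OF sym diag] algebra_simps flip: exp_add)
    have "(\<sigma> $ j - tanh x) * exp (\<sigma> $ j * x) = (\<sigma> $ j + tanh x) * exp (- (\<sigma> $ j * x))"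
    proof -
      have "\<sigma> $ j = 1 \<or> \<sigma> $ j = -1" using that by (auto simp: sign_vectors_def)
      then show ?thesis
      proof
        assume "\<sigma> $ j = - 1"
        then show ?thesis using tanh_exp_balance[of x] by (simp add: algebra_simps)
      qed (use tanh_exp_balance[of x] in simp)
    qed
    then have "f \<sigma> * exp r * ((\<sigma> $ j - tanh x) * exp (\<sigma> $ j * x)) =
      f \<sigma> * exp r * ((\<sigma> $ j + tanh x) * exp (- (\<sigma> $ j * x)))" by simp
    then show ?thesis
      unfolding F_def tf tx inv e1 e2 by (simp add: flip_nth algebra_simps)
  qed
  then have "(\<Sum>\<sigma>\<in>sign_vectors. F \<sigma> + F (flip j \<sigma>)) = 0" by (simp add: sum.neutral)
  then have "(\<Sum>\<sigma>\<in>sign_vectors. F \<sigma>) = 0"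
    by (simp add: sum.distrib sum_flip[of F])
  then show ?thesis
    by (simp add: F_def t_def left_diff_distrib sum_subtractf)
qed

lemma norm_matrix_vector_le:
  fixes B :: "real^'d^'n"
  shows "norm (B *v v) \<le> norm B * norm v"
proof -
  have "\<bar>(B *v v) $ i\<bar> \<le> norm (B $ i) * norm v" for i
    by (simp add: matrix_vector_mul_component Cauchy_Schwarz_ineq2)
  then have "norm (B *v v) \<le> L2_set (\<lambda>i. norm (B $ i) * norm v) UNIV"
    unfolding norm_vec_def by (intro L2_set_mono) auto
  also have "\<dots> = norm B * norm v"
    by (simp add: norm_vec_def[of B] L2_set_left_distrib)
  finally show ?thesis .
qed

lemma abs_tanh_le: "\<bar>tanh x\<bar> \<le> \<bar>x::real\<bar>"
proof -
  have nonneg: "tanh z \<le> z" if "z \<ge> 0" for z :: real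
  proof -
    have "(\<lambda>u. u - tanh u) 0 \<le> (\<lambda>u. u - tanh u) z"
    proof (rule DERIV_nonneg_imp_nondecreasing[OF that])
      fix u :: real
      show "\<exists>D. ((\<lambda>u. u - tanh u) has_real_derivative D) (at u) \<and> 0 \<le> D"
        by (rule exI[of _ "(tanh u)\<^sup>2"]) (auto intro!: derivative_eq_intros)
    qed
    then show ?thesis by simp
  qed
  show ?thesis using nonneg[of "\<bar>x\<bar>"] by simp
qed

text \<open>Expand \<open>\<parallel>B \<sigma>\<parallel>\<^sup>2 = \<Sum>\<^sub>j \<sigma>\<^sub>j (B B \<sigma>)\<^sub>j\<close> and sum by parts in each \<open>j\<close>. The diagonal of \<open>B B\<close> contributes at most the
  squared Frobenius norm, and what remains is \<open>\<langle>t, B B \<sigma>\<rangle>\<close> with \<open>\<bar>t\<^sub>j\<bar> \<le> 2 s \<bar>(B \<sigma>)\<^sub>j\<bar>\<close>, hence at most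
  \<open>2 s b \<parallel>B \<sigma>\<parallel>\<^sup>2\<close>. This term is absorbed on the left-hand side.\<close>

lemma tilted_norm_bound:
  fixes B :: "real^'d^'d"
  assumes sym: "transpose B = B" and diag: "\<And>j. B $ j $ j = 0"
    and b: "norm B \<le> b" and s: "0 \<le> s"
  shows "(1 - 2 * s * b) * (\<Sum>\<sigma>\<in>sign_vectors. exp (s * chaos B \<sigma>) * (norm (B *v \<sigma>))\<^sup>2)
    \<le> b\<^sup>2 * (\<Sum>\<sigma>\<in>sign_vectors. exp (s * chaos B \<sigma>))"
proof -
  define w where "w \<sigma> = exp (s * chaos B \<sigma>)" for \<sigma>
  define t where "t \<sigma> = (\<chi> j. tanh (2 * s * (B *v \<sigma>) $ j))" for \<sigma>
  define D where "D j = (\<Sum>k\<in>UNIV. (B $ j $ k)\<^sup>2)" for j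
  have w0: "0 \<le> w \<sigma>" for \<sigma> by (simp add: w_def)
  have b0: "0 \<le> b" using b norm_ge_zero order_trans by blast
  have symc: "B $ k $ j = B $ j $ k" for j k
    using arg_cong[OF sym, of "\<lambda>M. M $ j $ k"] by (simp add: transpose_def)
  have BB: "(B *v (B *v flip j \<sigma>)) $ j = (B *v (B *v \<sigma>)) $ j - 2 * \<sigma> $ j * D j" for j \<sigma>
  proof -
    have "(B *v column j B) $ j = D j"
      by (simp add: matrix_vector_mult_def column_def D_def power2_eq_square symc[of _ j])
    then show ?thesis
      unfolding flip_def
      by (simp add: matrix_vector_mult_diff_distrib matrix_vector_mult_scaleR matrix_vector_axis)
  qed
  have sumD: "(\<Sum>j\<in>UNIV. D j) \<le> b\<^sup>2"
  proof -
    have "(\<Sum>j\<in>UNIV. D j) = (norm B)\<^sup>2"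
      by (simp add: D_def norm_vec_def L2_set_def sum_nonneg)
    then show ?thesis using b by (simp add: power_mono)
  qed
  have parts: "(\<Sum>\<sigma>\<in>sign_vectors. w \<sigma> * (\<sigma> $ j * (B *v (B *v \<sigma>)) $ j))
      \<le> (\<Sum>\<sigma>\<in>sign_vectors. w \<sigma> * (t \<sigma> $ j * (B *v (B *v \<sigma>)) $ j + D j))" for j
  proof -
    \<comment> \<open>The component of \<open>B B \<sigma>\<close> contains \<open>\<sigma>\<^sub>j\<close> with coefficient \<open>D j\<close>, which has to be removed before
      summing by parts.\<close>
    define n where "n \<sigma> = (B *v (B *v \<sigma>)) $ j - \<sigma> $ j * D j" for \<sigma>
    have n: "n (flip j \<sigma>) = n \<sigma>" for \<sigma> by (simp add: n_def BB flip_nth)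
    have tt: "t (flip j \<sigma>) $ j = t \<sigma> $ j" for \<sigma> by (simp add: t_def flip_apply_nth diag)
    have sq: "\<sigma> $ j * \<sigma> $ j = 1" if "\<sigma> \<in> sign_vectors" for \<sigma>
    proof -
      have "\<sigma> $ j = 1 \<or> \<sigma> $ j = -1" using that by (simp add: sign_vectors_def)
      then show ?thesis by auto
    qed
    have "(\<Sum>\<sigma>\<in>sign_vectors. w \<sigma> * (\<sigma> $ j * (B *v (B *v \<sigma>)) $ j))
        = (\<Sum>\<sigma>\<in>sign_vectors. \<sigma> $ j * n \<sigma> * w \<sigma> + w \<sigma> * D j)"
    proof (rule sum.cong[OF refl])
      fix \<sigma> assume a: "\<sigma> \<in> (sign_vectors :: (real^'d) set)"
      have "\<sigma> $ j * n \<sigma> * w \<sigma> + w \<sigma> * D j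
          = w \<sigma> * (\<sigma> $ j * (B *v (B *v \<sigma>)) $ j) + w \<sigma> * D j * (1 - \<sigma> $ j * \<sigma> $ j)"
        unfolding n_def by (simp add: algebra_simps del: mult_cancel_left mult_cancel_right)
      then show "w \<sigma> * (\<sigma> $ j * (B *v (B *v \<sigma>)) $ j) = \<sigma> $ j * n \<sigma> * w \<sigma> + w \<sigma> * D j"
        by (simp only: sq[OF a] diff_self mult_zero_right add_0_right)
    qed
    also have "\<dots> = (\<Sum>\<sigma>\<in>sign_vectors. t \<sigma> $ j * n \<sigma> * w \<sigma> + w \<sigma> * D j)"
      using sum_by_parts_sign[where f = n, OF sym diag n, where s = s]
      by (simp add: sum.distrib w_def t_def)
    also have "\<dots> = (\<Sum>\<sigma>\<in>sign_vectors. w \<sigma> * (t \<sigma> $ j * (B *v (B *v \<sigma>)) $ j + D j))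
        - D j * (\<Sum>\<sigma>\<in>sign_vectors. \<sigma> $ j * t \<sigma> $ j * w \<sigma>)"
      by (simp add: n_def algebra_simps sum_distrib_left sum_subtractf sum.distrib)
    \<comment> \<open>A second summation by parts shows that the correction term has a sign and can be dropped.\<close>
    also have "(\<Sum>\<sigma>\<in>sign_vectors. \<sigma> $ j * t \<sigma> $ j * w \<sigma>)
        = (\<Sum>\<sigma>\<in>sign_vectors. t \<sigma> $ j * t \<sigma> $ j * w \<sigma>)"
      using sum_by_parts_sign[where f = "\<lambda>\<sigma>. t \<sigma> $ j", OF sym diag tt, where s = s]
      by (simp add: w_def t_def)
    finally have "(\<Sum>\<sigma>\<in>sign_vectors. w \<sigma> * (\<sigma> $ j * (B *v (B *v \<sigma>)) $ j))
        = (\<Sum>\<sigma>\<in>sign_vectors. w \<sigma> * (t \<sigma> $ j * (B *v (B *v \<sigma>)) $ j + D j))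
        - D j * (\<Sum>\<sigma>\<in>sign_vectors. t \<sigma> $ j * t \<sigma> $ j * w \<sigma>)" .
    moreover have "0 \<le> D j * (\<Sum>\<sigma>\<in>sign_vectors. t \<sigma> $ j * t \<sigma> $ j * w \<sigma>)"
      by (intro mult_nonneg_nonneg sum_nonneg w0 zero_le_square) (simp add: D_def sum_nonneg)
    ultimately show ?thesis by simp
  qed
  have inner: "t \<sigma> \<bullet> (B *v (B *v \<sigma>)) \<le> 2 * s * b * (norm (B *v \<sigma>))\<^sup>2" for \<sigma>
  proof -
    have "norm (t \<sigma>) \<le> norm ((2 * s) *\<^sub>R (B *v \<sigma>))"
      by (rule norm_le_componentwise_cart) (use abs_tanh_le in \<open>simp add: t_def\<close>)
    then have 1: "norm (t \<sigma>) \<le> 2 * s * norm (B *v \<sigma>)" using s by simp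
    have "norm (B *v (B *v \<sigma>)) \<le> norm B * norm (B *v \<sigma>)" by (rule norm_matrix_vector_le)
    also have "\<dots> \<le> b * norm (B *v \<sigma>)" using b by (simp add: mult_right_mono)
    finally have 2: "norm (B *v (B *v \<sigma>)) \<le> b * norm (B *v \<sigma>)" .
    have "t \<sigma> \<bullet> (B *v (B *v \<sigma>)) \<le> norm (t \<sigma>) * norm (B *v (B *v \<sigma>))" by (rule norm_cauchy_schwarz)
    also have "\<dots> \<le> (2 * s * norm (B *v \<sigma>)) * (b * norm (B *v \<sigma>))"
      by (rule mult_mono[OF 1 2]) (use s in auto)
    finally show ?thesis by (simp add: power2_eq_square algebra_simps)
  qed
  have "(\<Sum>\<sigma>\<in>sign_vectors. w \<sigma> * (norm (B *v \<sigma>))\<^sup>2) = (\<Sum>\<sigma>\<in>sign_vectors. w \<sigma> * (\<sigma> \<bullet> (B *v (B *v \<sigma>))))"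
    by (simp add: power2_norm_eq_inner symmetric_inner[OF sym])
  also have "\<dots> = (\<Sum>j\<in>UNIV. \<Sum>\<sigma>\<in>sign_vectors. w \<sigma> * (\<sigma> $ j * (B *v (B *v \<sigma>)) $ j))"
    by (subst sum.swap) (simp add: inner_vec_def sum_distrib_left)
  also have "\<dots> \<le> (\<Sum>j\<in>UNIV. \<Sum>\<sigma>\<in>sign_vectors. w \<sigma> * (t \<sigma> $ j * (B *v (B *v \<sigma>)) $ j + D j))"
    by (intro sum_mono parts)
  also have "\<dots> = (\<Sum>\<sigma>\<in>sign_vectors. w \<sigma> * (t \<sigma> \<bullet> (B *v (B *v \<sigma>)) + (\<Sum>j\<in>UNIV. D j)))"
    by (subst sum.swap) (simp add: inner_vec_def sum_distrib_left[symmetric] sum.distrib)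
  also have "\<dots> \<le> (\<Sum>\<sigma>\<in>sign_vectors. w \<sigma> * (2 * s * b * (norm (B *v \<sigma>))\<^sup>2 + b\<^sup>2))"
    by (intro sum_mono mult_left_mono add_mono inner sumD w0)
  also have "\<dots> = 2 * s * b * (\<Sum>\<sigma>\<in>sign_vectors. w \<sigma> * (norm (B *v \<sigma>))\<^sup>2) + b\<^sup>2 * (\<Sum>\<sigma>\<in>sign_vectors. w \<sigma>)"
    by (simp add: algebra_simps sum.distrib sum_distrib_left sum_distrib_right)
  finally show ?thesis by (simp add: w_def algebra_simps)
qed

text \<open>This controls the logarithmic derivative in \<open>s\<close> of the moment generating function.\<close>

lemma tilted_chaos_bound:
  fixes B :: "real^'d^'d"
  assumes sym: "transpose B = B" and diag: "\<And>j. B $ j $ j = 0"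
    and b: "norm B \<le> b" and s: "0 \<le> s" and small: "2 * s * b < 1"
  shows "(\<Sum>\<sigma>\<in>sign_vectors. chaos B \<sigma> * exp (s * chaos B \<sigma>))
    \<le> 2 * s * b\<^sup>2 / (1 - 2 * s * b) * (\<Sum>\<sigma>\<in>sign_vectors. exp (s * chaos B \<sigma>))"
proof -
  have inv: "(B *v flip j \<sigma>) $ j = (B *v \<sigma>) $ j" for j \<sigma> by (simp add: flip_apply_nth diag)
  have tanh_le: "tanh (2 * s * m) * m \<le> 2 * s * m\<^sup>2" for m
  proof -
    have "tanh (2 * s * m) * m \<le> \<bar>tanh (2 * s * m)\<bar> * \<bar>m\<bar>" by (metis abs_ge_self abs_mult)
    also have "\<dots> \<le> \<bar>2 * s * m\<bar> * \<bar>m\<bar>" by (intro mult_right_mono abs_tanh_le) auto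
    also have "\<dots> = 2 * s * m\<^sup>2" using s by (simp add: abs_mult power2_eq_square)
    finally show ?thesis .
  qed
  have "(\<Sum>\<sigma>\<in>sign_vectors. chaos B \<sigma> * exp (s * chaos B \<sigma>))
      = (\<Sum>j\<in>UNIV. \<Sum>\<sigma>\<in>sign_vectors. \<sigma> $ j * (B *v \<sigma>) $ j * exp (s * chaos B \<sigma>))"
    by (subst sum.swap) (simp add: chaos_def[of B] inner_vec_def flip: sum_distrib_right)
  also have "\<dots> = (\<Sum>j\<in>UNIV. \<Sum>\<sigma>\<in>sign_vectors. tanh (2 * s * (B *v \<sigma>) $ j) * (B *v \<sigma>) $ j * exp (s * chaos B \<sigma>))"
    by (intro sum.cong refl sum_by_parts_sign[where f = "\<lambda>\<sigma>. (B *v \<sigma>) $ j" for j] sym diag inv)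
  also have "\<dots> \<le> (\<Sum>j\<in>UNIV. \<Sum>\<sigma>\<in>sign_vectors. 2 * s * ((B *v \<sigma>) $ j)\<^sup>2 * exp (s * chaos B \<sigma>))"
    by (intro sum_mono mult_right_mono tanh_le) auto
  also have "\<dots> = 2 * s * (\<Sum>\<sigma>\<in>sign_vectors. exp (s * chaos B \<sigma>) * (norm (B *v \<sigma>))\<^sup>2)"
    by (subst sum.swap) (simp add: power2_norm_vec sum_distrib_left mult_ac)
  also have "\<dots> \<le> 2 * s * (b\<^sup>2 / (1 - 2 * s * b) * (\<Sum>\<sigma>\<in>sign_vectors. exp (s * chaos B \<sigma>)))"
    using tilted_norm_bound[OF sym diag b s] s small
    by (intro mult_left_mono) (auto simp: field_simps)
  finally show ?thesis by (simp add: mult.assoc)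
qed

lemma card_sign_vectors: "card (sign_vectors :: (real^'d) set) = 2 ^ CARD('d)"
proof -
  have "bij_betw vec_lambda (PiE (UNIV :: 'd set) (\<lambda>_. {1, -1 :: real})) sign_vectors"
    by (rule bij_betwI[where g = vec_nth]) (auto simp: sign_vectors_def)
  then have "card (sign_vectors :: (real^'d) set) = card (PiE (UNIV :: 'd set) (\<lambda>_. {1, -1 :: real}))"
    by (simp add: bij_betw_same_card)
  then show ?thesis by (simp add: card_PiE numeral_2_eq_2)
qed

text \<open>Integrating \<open>2 s b\<^sup>2 / (1 - 2 s b)\<close> over \<open>0 \<le> s \<le> 1\<close> gives \<open>- b - ln (1 - 2 b) / 2\<close>. A Gaussian form with
  trace zero satisfies the same bound, because its logarithmic moment generating function is
  \<open>\<Sum> (- \<mu> - ln (1 - 2 \<mu>) / 2)\<close> over the eigenvalues \<open>\<mu>\<close>, and the power sums of the eigenvalues are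
  at most the powers of \<open>b\<close>.\<close>

lemma rademacher_chaos_mgf:
  fixes B :: "real^'d^'d"
  assumes sym: "transpose B = B" and diag: "\<And>j. B $ j $ j = 0"
    and b: "norm B \<le> b" and small: "2 * b < 1"
  shows "(\<Sum>\<sigma>\<in>sign_vectors. exp (chaos B \<sigma>)) / 2 ^ CARD('d) \<le> exp (- b - ln (1 - 2 * b) / 2)"
proof -
  define N where "N s = (\<Sum>\<sigma>\<in>sign_vectors. exp (s * chaos B \<sigma>))" for s
  define H where "H s = b * s + ln (1 - 2 * b * s) / 2" for s
  have b0: "0 \<le> b" using b norm_ge_zero order_trans by blast
  have "N 1 * exp (H 1) \<le> N 0 * exp (H 0)"
  proof (rule DERIV_nonpos_imp_nonincreasing[of 0 1 "\<lambda>s. N s * exp (H s)"])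
    fix s :: real assume s: "0 \<le> s" "s \<le> 1"
    have sm: "2 * s * b < 1" using mult_left_le_one_le[of "2 * b" s] s small b0 by (simp add: mult_ac)
    define N' where "N' = (\<Sum>\<sigma>\<in>sign_vectors. chaos B \<sigma> * exp (s * chaos B \<sigma>))"
    define H' where "H' = b - b / (1 - 2 * b * s)"
    have 1: "(N has_real_derivative N') (at s)"
      unfolding N_def N'_def by (auto intro!: derivative_eq_intros simp: mult.commute)
    have 2: "(H has_real_derivative H') (at s)"
      unfolding H_def H'_def using sm by (auto intro!: derivative_eq_intros simp: field_simps)
    have 3: "((\<lambda>s. N s * exp (H s)) has_real_derivative (N' + N s * H') * exp (H s)) (at s)"
      by (auto intro!: derivative_eq_intros 1 2 simp: algebra_simps)
    have "H' = - (2 * s * b\<^sup>2 / (1 - 2 * s * b))"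
      using sm by (simp add: H'_def field_simps power2_eq_square)
    then have "N' + N s * H' \<le> 0"
      using tilted_chaos_bound[OF sym diag b s(1) sm] by (simp add: N_def N'_def mult.commute)
    then show "\<exists>y. ((\<lambda>s. N s * exp (H s)) has_real_derivative y) (at s) \<and> y \<le> 0"
      using 3 by (meson exp_ge_zero mult_nonpos_nonneg)
  qed simp
  then have "N 1 * exp (H 1) \<le> 2 ^ CARD('d)"
    by (simp add: N_def H_def card_sign_vectors)
  then have "N 1 / 2 ^ CARD('d) \<le> exp (- H 1)"
    by (simp add: exp_minus field_simps)
  then show ?thesis by (simp add: N_def H_def)
qed

section \<open>The product of two orthogonal sums of random signs\<close>

text \<open>The symmetric matrix of the form \<open>\<beta> X (W - \<delta> X)\<close> with its diagonal deleted. On signs the deleted diagonal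
  only contributes the constant \<open>- \<beta> \<delta>\<close>, its trace.\<close>

definition tilt_matrix :: "real \<Rightarrow> real \<Rightarrow> real^'d \<Rightarrow> real^'d \<Rightarrow> real^'d^'d" where
  "tilt_matrix \<beta> \<delta> y w = (\<chi> j k. if j = k then 0
     else \<beta> * ((y $ j * w $ k + w $ j * y $ k) / 2 - \<delta> * y $ j * y $ k))"

lemma tilt_matrix_sym: "transpose (tilt_matrix \<beta> \<delta> y w) = tilt_matrix \<beta> \<delta> y w"
  by (auto simp: tilt_matrix_def transpose_def vec_eq_iff algebra_simps)

lemma tilt_matrix_diag: "tilt_matrix \<beta> \<delta> y w $ j $ j = 0"
  by (simp add: tilt_matrix_def)

lemma chaos_tilt_matrix:
  fixes y w :: "real^'d"
  assumes y: "norm y = 1" and orth: "y \<bullet> w = 0" and \<sigma>: "\<sigma> \<in> sign_vectors"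
  shows "chaos (tilt_matrix \<beta> \<delta> y w) \<sigma> = \<beta> * (\<sigma> \<bullet> y) * (\<sigma> \<bullet> w - \<delta> * (\<sigma> \<bullet> y)) + \<beta> * \<delta>"
proof -
  define b where "b j k = \<beta> * ((y $ j * w $ k + w $ j * y $ k) / 2 - \<delta> * y $ j * y $ k)" for j k
  have sq: "\<sigma> $ j * \<sigma> $ j = 1" for j
  proof -
    have "\<sigma> $ j = 1 \<or> \<sigma> $ j = -1" using \<sigma> by (simp add: sign_vectors_def)
    then show ?thesis by auto
  qed
  have "chaos (tilt_matrix \<beta> \<delta> y w) \<sigma>
      = (\<Sum>j\<in>UNIV. \<Sum>k\<in>UNIV. \<sigma> $ j * (b j k - (if j = k then b j k else 0)) * \<sigma> $ k)"
    unfolding chaos_def inner_vec_def matrix_vector_mult_def tilt_matrix_def b_def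
    by (auto simp: sum_distrib_left mult_ac intro!: sum.cong)
  also have "\<dots> = (\<Sum>j\<in>UNIV. (\<Sum>k\<in>UNIV. \<sigma> $ j * b j k * \<sigma> $ k) - b j j)"
  proof (rule sum.cong[OF refl])
    fix j
    have "\<sigma> $ j * (b j k - (if j = k then b j k else 0)) * \<sigma> $ k
       = \<sigma> $ j * b j k * \<sigma> $ k - (if j = k then b j j else 0)" for k
      using sq[of j] by (auto simp: algebra_simps)
    then show "(\<Sum>k\<in>UNIV. \<sigma> $ j * (b j k - (if j = k then b j k else 0)) * \<sigma> $ k)
        = (\<Sum>k\<in>UNIV. \<sigma> $ j * b j k * \<sigma> $ k) - b j j"
      by (simp add: sum_subtractf)
  qed
  also have "\<dots> = (\<Sum>j\<in>UNIV. \<Sum>k\<in>UNIV. \<sigma> $ j * b j k * \<sigma> $ k) - (\<Sum>j\<in>UNIV. b j j)"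
    by (simp add: sum_subtractf)
  also have "(\<Sum>j\<in>UNIV. b j j) = \<beta> * (y \<bullet> w) - \<beta> * \<delta> * (y \<bullet> y)"
    by (simp add: b_def inner_vec_def sum_subtractf sum_distrib_left algebra_simps)
  also have "\<dots> = - \<beta> * \<delta>"
    using y orth by (simp add: norm_eq_1)
  also have "(\<Sum>j\<in>UNIV. \<Sum>k\<in>UNIV. \<sigma> $ j * b j k * \<sigma> $ k)
      = \<beta> / 2 * ((\<sigma> \<bullet> y) * (\<sigma> \<bullet> w)) + \<beta> / 2 * ((\<sigma> \<bullet> w) * (\<sigma> \<bullet> y)) - \<beta> * \<delta> * ((\<sigma> \<bullet> y) * (\<sigma> \<bullet> y))"
    unfolding inner_vec_def inner_real_def sum_product
    by (simp add: b_def algebra_simps add_divide_distrib diff_divide_distrib sum.distrib sum_subtractf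
        sum_distrib_left sum_divide_distrib)
  finally show ?thesis by (simp add: algebra_simps)
qed

text \<open>The full matrix is \<open>\<beta>\<close> times the sum of the symmetrised \<open>y w\<^sup>T\<close> and \<open>- \<delta> y y\<^sup>T\<close>. By orthogonality these
  two are perpendicular for the Frobenius inner product, with squared norms \<open>\<parallel>w\<parallel>\<^sup>2 / 2\<close> and \<open>\<delta>\<^sup>2\<close>.\<close>

lemma norm_tilt_matrix:
  fixes y w :: "real^'d"
  assumes y: "norm y = 1" and orth: "y \<bullet> w = 0" and w: "norm w \<le> 1" and b: "0 \<le> b"
    and bb: "\<beta>\<^sup>2 * (1 / 2 + \<delta>\<^sup>2) \<le> b\<^sup>2"
  shows "norm (tilt_matrix \<beta> \<delta> y w) \<le> b"
proof (rule power2_le_imp_le[OF _ b])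
  define c where "c j k = \<beta> * ((y $ j * w $ k + w $ j * y $ k) / 2 - \<delta> * y $ j * y $ k)" for j k
  have csq: "(c j k)\<^sup>2 = \<beta>\<^sup>2 * ((y $ j)\<^sup>2 * (w $ k)\<^sup>2 / 4 + (w $ j)\<^sup>2 * (y $ k)\<^sup>2 / 4 + \<delta>\<^sup>2 * ((y $ j)\<^sup>2 * (y $ k)\<^sup>2)
      + (y $ j * w $ j) * (y $ k * w $ k) / 2
      - \<delta> * ((y $ j)\<^sup>2 * (y $ k * w $ k)) - \<delta> * ((y $ j * w $ j) * (y $ k)\<^sup>2))" for j k
    unfolding c_def by (simp add: power2_eq_square field_simps)
  have "(norm (tilt_matrix \<beta> \<delta> y w))\<^sup>2 = (\<Sum>j\<in>UNIV. \<Sum>k\<in>UNIV. (tilt_matrix \<beta> \<delta> y w $ j $ k)\<^sup>2)"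
    by (simp add: norm_vec_def L2_set_def sum_nonneg)
  also have "\<dots> \<le> (\<Sum>j\<in>UNIV. \<Sum>k\<in>UNIV. (c j k)\<^sup>2)"
    by (intro sum_mono) (auto simp: tilt_matrix_def c_def)
  also have "\<dots> = \<beta>\<^sup>2 * ((norm y)\<^sup>2 * (norm w)\<^sup>2 / 4 + (norm w)\<^sup>2 * (norm y)\<^sup>2 / 4 + \<delta>\<^sup>2 * ((norm y)\<^sup>2 * (norm y)\<^sup>2)
      + (y \<bullet> w) * (y \<bullet> w) / 2
      - \<delta> * ((norm y)\<^sup>2 * (y \<bullet> w)) - \<delta> * ((y \<bullet> w) * (norm y)\<^sup>2))"
    unfolding csq power2_norm_vec inner_vec_def inner_real_def sum_product
    by (simp add: algebra_simps sum_distrib_left sum_divide_distrib sum.distrib sum_subtractf)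
  also have "\<dots> = \<beta>\<^sup>2 * ((norm w)\<^sup>2 / 2 + \<delta>\<^sup>2)" by (simp add: y orth)
  also have "\<dots> \<le> \<beta>\<^sup>2 * (1 / 2 + \<delta>\<^sup>2)"
    using w by (intro mult_left_mono add_right_mono divide_right_mono) (auto simp: power_le_one)
  also note bb
  finally show "(norm (tilt_matrix \<beta> \<delta> y w))\<^sup>2 \<le> b\<^sup>2" .
qed

lemma rademacher_tilt_bound:
  fixes y w :: "real^'d"
  assumes "norm y = 1" and "y \<bullet> w = 0" and "norm w \<le> 1" and "0 \<le> b"
    and "\<beta>\<^sup>2 * (1 / 2 + \<delta>\<^sup>2) \<le> b\<^sup>2" and "2 * b < 1"
  shows "(\<Sum>\<sigma>\<in>sign_vectors. exp (\<beta> * (\<sigma> \<bullet> y) * (\<sigma> \<bullet> w - \<delta> * (\<sigma> \<bullet> y)))) / 2 ^ CARD('d)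
     \<le> exp (- (\<beta> * \<delta>) - b - ln (1 - 2 * b) / 2)"
proof -
  let ?B = "tilt_matrix \<beta> \<delta> y w"
  have "(\<Sum>\<sigma>\<in>sign_vectors. exp (\<beta> * (\<sigma> \<bullet> y) * (\<sigma> \<bullet> w - \<delta> * (\<sigma> \<bullet> y))))
      = exp (- (\<beta> * \<delta>)) * (\<Sum>\<sigma>\<in>sign_vectors. exp (chaos ?B \<sigma>))"
    unfolding sum_distrib_left
  proof (rule sum.cong[OF refl])
    fix \<sigma> assume "\<sigma> \<in> (sign_vectors :: (real^'d) set)"
    then show "exp (\<beta> * (\<sigma> \<bullet> y) * (\<sigma> \<bullet> w - \<delta> * (\<sigma> \<bullet> y))) = exp (- (\<beta> * \<delta>)) * exp (chaos ?B \<sigma>)"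
      using assms by (simp add: chaos_tilt_matrix flip: exp_add)
  qed
  moreover have "(\<Sum>\<sigma>\<in>sign_vectors. exp (chaos ?B \<sigma>)) / 2 ^ CARD('d) \<le> exp (- b - ln (1 - 2 * b) / 2)"
    by (rule rademacher_chaos_mgf[OF tilt_matrix_sym tilt_matrix_diag]) (use assms norm_tilt_matrix in auto)
  ultimately have "(\<Sum>\<sigma>\<in>sign_vectors. exp (\<beta> * (\<sigma> \<bullet> y) * (\<sigma> \<bullet> w - \<delta> * (\<sigma> \<bullet> y)))) / 2 ^ CARD('d)
     \<le> exp (- (\<beta> * \<delta>)) * exp (- b - ln (1 - 2 * b) / 2)"
    by (simp add: mult_left_mono flip: times_divide_eq_right)
  then show ?thesis by (simp only: exp_add[symmetric] add_diff_eq diff_conv_add_uminus add.assoc)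
qed

section \<open>The product of two orthogonal Gaussian sums\<close>

abbreviation std_normal :: "real measure" where
  "std_normal \<equiv> density lborel (\<lambda>u. ennreal (std_normal_density u))"

lemma std_normal_quadratic_mgf:
  fixes a b c :: real
  assumes c: "2 * c < 1"
  shows "(\<integral>\<^sup>+u. ennreal (exp (a + b * u + c * u\<^sup>2)) \<partial>std_normal)
    = ennreal (exp (a + b\<^sup>2 / (2 * (1 - 2 * c))) / sqrt (1 - 2 * c))"
proof -
  define \<tau> where "\<tau> = 1 - 2 * c"
  have \<tau>: "\<tau> > 0" using c by (simp add: \<tau>_def)
  define K where "K = exp (a + b\<^sup>2 / (2 * \<tau>)) / sqrt \<tau>"
  have "K \<ge> 0" using \<tau> by (simp add: K_def)
  have eq: "std_normal_density u * exp (a + b * u + c * u\<^sup>2)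
      = K * normal_density (b / \<tau>) (1 / sqrt \<tau>) u" for u
  proof -
    have sq: "sqrt (2 * pi * (1 / sqrt \<tau>)\<^sup>2) = sqrt (2 * pi) / sqrt \<tau>"
      using \<tau> by (simp add: power_divide real_sqrt_divide)
    have ex: "- u\<^sup>2 / 2 + (a + b * u + c * u\<^sup>2)
       = (a + b\<^sup>2 / (2 * \<tau>)) + - (u - b / \<tau>)\<^sup>2 / (2 * (1 / sqrt \<tau>)\<^sup>2)"
    proof -
      have c': "c = (1 - \<tau>) / 2" by (simp add: \<tau>_def)
      show ?thesis
        unfolding c' using \<tau> by (simp add: power_divide field_simps power2_eq_square)
    qed
    have "std_normal_density u * exp (a + b * u + c * u\<^sup>2)
       = 1 / sqrt (2 * pi) * exp (- u\<^sup>2 / 2 + (a + b * u + c * u\<^sup>2))"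
      by (simp add: std_normal_density_def flip: exp_add)
    also have "\<dots> = K * normal_density (b / \<tau>) (1 / sqrt \<tau>) u"
      unfolding ex normal_density_def sq K_def using \<tau> by (simp flip: exp_add)
    finally show ?thesis .
  qed
  have "(\<integral>\<^sup>+u. ennreal (exp (a + b * u + c * u\<^sup>2)) \<partial>std_normal)
     = (\<integral>\<^sup>+u. ennreal (std_normal_density u) * ennreal (exp (a + b * u + c * u\<^sup>2)) \<partial>lborel)"
    by (subst nn_integral_density) auto
  also have "\<dots> = (\<integral>\<^sup>+u. ennreal K * ennreal (normal_density (b / \<tau>) (1 / sqrt \<tau>) u) \<partial>lborel)"
    using \<open>K \<ge> 0\<close> by (simp add: eq flip: ennreal_mult)
  also have "\<dots> = ennreal K * (\<integral>\<^sup>+u. ennreal (normal_density (b / \<tau>) (1 / sqrt \<tau>) u) \<partial>lborel)"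
    by (rule nn_integral_cmult) auto
  also have "(\<integral>\<^sup>+u. ennreal (normal_density (b / \<tau>) (1 / sqrt \<tau>) u) \<partial>lborel) = 1"
    using \<tau> by (subst nn_integral_eq_integral) auto
  finally show ?thesis by (simp add: K_def \<tau>_def)
qed

text \<open>For \<open>q(p, s) = \<beta> p (s - \<delta> p)\<close> with matrix \<open>Q\<close>, and for \<open>G\<close> the Gram matrix with diagonal \<open>a, r\<close> and
  off-diagonal entry \<open>h\<close>, \<open>gauss_det\<close> is the determinant of \<open>I - 2 Q G\<close>, and \<open>gauss_form\<close> divided by it
  is the quadratic form of \<open>(I - 2 Q G)\<^sup>-\<^sup>1 Q\<close>.\<close>

definition gauss_det :: "real \<Rightarrow> real \<Rightarrow> real \<Rightarrow> real \<Rightarrow> real \<Rightarrow> real" where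
  "gauss_det \<beta> \<delta> a h r = 1 + 2 * \<beta> * \<delta> * a - 2 * \<beta> * h - \<beta>\<^sup>2 * (a * r - h\<^sup>2)"

definition gauss_form :: "real \<Rightarrow> real \<Rightarrow> real \<Rightarrow> real \<Rightarrow> real \<Rightarrow> real \<Rightarrow> real \<Rightarrow> real" where
  "gauss_form \<beta> \<delta> a h r p s =
     \<beta> * p * (s - \<delta> * p) + \<beta>\<^sup>2 / 2 * (r * p\<^sup>2 - 2 * h * p * s + a * s\<^sup>2)"

text \<open>Positivity is needed for every partial Gram matrix that occurs while the coordinates are
  integrated out. This is why it is derived from bounds that pass to subsums.\<close>

lemma gauss_det_pos:
  assumes "0 \<le> \<beta>" "0 \<le> \<delta>" "2 * \<beta> + \<beta>\<^sup>2 < 1" "0 \<le> a" "a \<le> 1" "0 \<le> r" "r \<le> 1" "2 * \<bar>h\<bar> \<le> a + r"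
  shows "0 < gauss_det \<beta> \<delta> a h r"
proof -
  have 1: "a * r \<le> 1" using assms mult_le_one by blast
  have "a * r - h\<^sup>2 \<le> 1" using 1 by (smt (verit) zero_le_power2)
  then have 2: "\<beta>\<^sup>2 * (a * r - h\<^sup>2) \<le> \<beta>\<^sup>2" by (simp add: mult_left_le)
  have "\<beta> * h \<le> \<beta> * 1" using assms by (intro mult_left_mono) auto
  moreover have "0 \<le> \<beta> * \<delta> * a" using assms by simp
  ultimately show ?thesis using 2 assms(3) unfolding gauss_det_def by (simp add: mult.assoc)
qed

text \<open>Integrating out one more coordinate with coefficients \<open>(p, s)\<close> adds the rank one matrix with
  entries \<open>p\<^sup>2, p s, s\<^sup>2\<close> to the Gram matrix and leaves the shape of the integral unchanged.\<close>

lemma gaussian_step: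
  fixes \<beta> \<delta> a h r p s x w :: real
  defines "D \<equiv> gauss_det \<beta> \<delta> a h r" and "D' \<equiv> gauss_det \<beta> \<delta> (a + p\<^sup>2) (h + p * s) (r + s\<^sup>2)"
  assumes D: "0 < D" and D': "0 < D'"
  shows "(\<integral>\<^sup>+u. ennreal (exp (gauss_form \<beta> \<delta> a h r (x + u * p) (w + u * s) / D) / sqrt D) \<partial>std_normal)
    = ennreal (exp (gauss_form \<beta> \<delta> (a + p\<^sup>2) (h + p * s) (r + s\<^sup>2) x w / D') / sqrt D')"
proof -
  define N where "N = gauss_form \<beta> \<delta> a h r"
  define P where "P = \<beta> * (p * w + s * x - 2 * \<delta> * p * x)
     + \<beta>\<^sup>2 * (r * p * x - h * (p * w + s * x) + a * s * w)"
  have expand: "N (x + u * p) (w + u * s) = N x w + P * u + N p s * u\<^sup>2" for u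
    unfolding N_def P_def gauss_form_def by (simp add: power2_eq_square algebra_simps)
  have DD: "D' = D - 2 * N p s"
    unfolding D'_def D_def N_def gauss_form_def gauss_det_def by (simp add: power2_eq_square algebra_simps)
  have c: "1 - 2 * (N p s / D) = D' / D" using D DD by (simp add: field_simps)
  have key: "2 * N x w * D' + P\<^sup>2 = 2 * gauss_form \<beta> \<delta> (a + p\<^sup>2) (h + p * s) (r + s\<^sup>2) x w * D"
    unfolding D'_def D_def N_def P_def gauss_form_def gauss_det_def power2_eq_square by algebra
  have final: "N x w / D + (P / D)\<^sup>2 / (2 * (1 - 2 * (N p s / D)))
     = gauss_form \<beta> \<delta> (a + p\<^sup>2) (h + p * s) (r + s\<^sup>2) x w / D'"
  proof -
    have "N x w / D + (P / D)\<^sup>2 / (2 * (D' / D)) = (2 * N x w * D' + P\<^sup>2) / (2 * D * D')"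
      using D D' by (simp add: field_simps power2_eq_square)
    then show ?thesis unfolding c key using D by simp
  qed
  have "(\<integral>\<^sup>+u. ennreal (exp (N (x + u * p) (w + u * s) / D) / sqrt D) \<partial>std_normal)
     = (\<integral>\<^sup>+u. ennreal (1 / sqrt D) * ennreal (exp (N x w / D + P / D * u + N p s / D * u\<^sup>2)) \<partial>std_normal)"
    using D by (intro nn_integral_cong) (simp add: expand add_divide_distrib flip: ennreal_mult)
  also have "\<dots> = ennreal (1 / sqrt D) * (\<integral>\<^sup>+u. ennreal (exp (N x w / D + P / D * u + N p s / D * u\<^sup>2)) \<partial>std_normal)"
    by (rule nn_integral_cmult) auto
  also have "\<dots> = ennreal (1 / sqrt D) * ennreal (exp (N x w / D + (P / D)\<^sup>2 / (2 * (1 - 2 * (N p s / D)))) / sqrt (1 - 2 * (N p s / D)))"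
  proof (subst std_normal_quadratic_mgf)
    have "0 < 1 - 2 * (N p s / D)" unfolding c using D D' by simp
    then show "2 * (N p s / D) < 1" by simp
  qed simp
  also have "\<dots> = ennreal (exp (gauss_form \<beta> \<delta> (a + p\<^sup>2) (h + p * s) (r + s\<^sup>2) x w / D') / sqrt D')"
    unfolding final unfolding c using D D' by (simp add: real_sqrt_divide flip: ennreal_mult)
  finally show ?thesis by (simp add: N_def)
qed

text \<open>The shifts \<open>p\<close> and \<open>s\<close> make the induction possible: they collect the coordinates that have not been
  integrated yet.\<close>

lemma gaussian_quadratic_mgf:
  fixes y w :: "'d \<Rightarrow> real"
  assumes "finite I" and \<beta>: "0 \<le> \<beta>" "2 * \<beta> + \<beta>\<^sup>2 < 1" and \<delta>: "0 \<le> \<delta>"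
    and "(\<Sum>j\<in>I. (y j)\<^sup>2) \<le> 1" and "(\<Sum>j\<in>I. (w j)\<^sup>2) \<le> 1"
  shows "(\<integral>\<^sup>+g. ennreal (exp (\<beta> * (p + (\<Sum>j\<in>I. g j * y j))
              * ((s + (\<Sum>j\<in>I. g j * w j)) - \<delta> * (p + (\<Sum>j\<in>I. g j * y j))))) \<partial>PiM I (\<lambda>_. std_normal))
    = ennreal (exp (gauss_form \<beta> \<delta> (\<Sum>j\<in>I. (y j)\<^sup>2) (\<Sum>j\<in>I. y j * w j) (\<Sum>j\<in>I. (w j)\<^sup>2) p s
         / gauss_det \<beta> \<delta> (\<Sum>j\<in>I. (y j)\<^sup>2) (\<Sum>j\<in>I. y j * w j) (\<Sum>j\<in>I. (w j)\<^sup>2))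
         / sqrt (gauss_det \<beta> \<delta> (\<Sum>j\<in>I. (y j)\<^sup>2) (\<Sum>j\<in>I. y j * w j) (\<Sum>j\<in>I. (w j)\<^sup>2)))"
  using assms(1,5,6)
proof (induction I arbitrary: p s rule: finite_induct)
  case empty
  then show ?case
    by (simp add: PiM_empty gauss_form_def gauss_det_def)
next
  case (insert i I)
  interpret product_sigma_finite "\<lambda>_ :: 'd. std_normal"
    by (intro product_sigma_finite.intro prob_space_imp_sigma_finite prob_space_normal_density) simp
  have pos: "0 < gauss_det \<beta> \<delta> (\<Sum>j\<in>J. (y j)\<^sup>2) (\<Sum>j\<in>J. y j * w j) (\<Sum>j\<in>J. (w j)\<^sup>2)"
    if "J \<subseteq> insert i I" for J
  proof (rule gauss_det_pos[OF \<beta>(1) \<delta> \<beta>(2)])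
    have fin: "finite (insert i I)" using insert by simp
    show "(\<Sum>j\<in>J. (y j)\<^sup>2) \<le> 1"
      using sum_mono2[OF fin that, of "\<lambda>j. (y j)\<^sup>2"] insert.prems by simp
    show "(\<Sum>j\<in>J. (w j)\<^sup>2) \<le> 1"
      using sum_mono2[OF fin that, of "\<lambda>j. (w j)\<^sup>2"] insert.prems by simp
    have "2 * \<bar>\<Sum>j\<in>J. y j * w j\<bar> \<le> (\<Sum>j\<in>J. 2 * \<bar>y j * w j\<bar>)"
      by (simp add: sum_distrib_left[symmetric])
    also have "\<dots> \<le> (\<Sum>j\<in>J. (y j)\<^sup>2 + (w j)\<^sup>2)"
    proof (rule sum_mono)
      fix j show "2 * \<bar>y j * w j\<bar> \<le> (y j)\<^sup>2 + (w j)\<^sup>2"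
        using sum_squares_bound[of "\<bar>y j\<bar>" "\<bar>w j\<bar>"] by (simp add: abs_mult)
    qed
    finally show "2 * \<bar>\<Sum>j\<in>J. y j * w j\<bar> \<le> (\<Sum>j\<in>J. (y j)\<^sup>2) + (\<Sum>j\<in>J. (w j)\<^sup>2)"
      by (simp add: sum.distrib)
  qed (auto intro: sum_nonneg)
  let ?a = "\<Sum>j\<in>I. (y j)\<^sup>2" and ?h = "\<Sum>j\<in>I. y j * w j" and ?r = "\<Sum>j\<in>I. (w j)\<^sup>2"
  let ?D = "gauss_det \<beta> \<delta> ?a ?h ?r"
  have le: "?a \<le> 1" "?r \<le> 1"
    using insert.prems insert.hyps by (auto intro: order_trans[rotated])
  have upd: "(\<Sum>j\<in>insert i I. (g(i := u)) j * z j) = u * z i + (\<Sum>j\<in>I. g j * z j)" for g :: "'d \<Rightarrow> real" and u z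
    using insert.hyps by (auto intro!: sum.cong)
  have "(\<integral>\<^sup>+g. ennreal (exp (\<beta> * (p + (\<Sum>j\<in>insert i I. g j * y j))
              * ((s + (\<Sum>j\<in>insert i I. g j * w j)) - \<delta> * (p + (\<Sum>j\<in>insert i I. g j * y j))))) \<partial>PiM (insert i I) (\<lambda>_. std_normal))
     = (\<integral>\<^sup>+u. (\<integral>\<^sup>+g. ennreal (exp (\<beta> * ((p + u * y i) + (\<Sum>j\<in>I. g j * y j))
              * (((s + u * w i) + (\<Sum>j\<in>I. g j * w j)) - \<delta> * ((p + u * y i) + (\<Sum>j\<in>I. g j * y j))))) \<partial>PiM I (\<lambda>_. std_normal)) \<partial>std_normal)"
    by (subst product_nn_integral_insert_rev[OF insert.hyps]) (simp_all add: upd add.assoc del: fun_upd_apply)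
  also have "\<dots> = (\<integral>\<^sup>+u. ennreal (exp (gauss_form \<beta> \<delta> ?a ?h ?r (p + u * y i) (s + u * w i) / ?D) / sqrt ?D) \<partial>std_normal)"
    using insert.IH[OF le] by simp
  also have "\<dots> = ennreal (exp (gauss_form \<beta> \<delta> (?a + (y i)\<^sup>2) (?h + y i * w i) (?r + (w i)\<^sup>2) p s
        / gauss_det \<beta> \<delta> (?a + (y i)\<^sup>2) (?h + y i * w i) (?r + (w i)\<^sup>2))
        / sqrt (gauss_det \<beta> \<delta> (?a + (y i)\<^sup>2) (?h + y i * w i) (?r + (w i)\<^sup>2)))"
    by (rule gaussian_step) (use pos[of I] pos[of "insert i I"] insert.hyps in \<open>auto simp: add.commute\<close>)
  finally show ?case using insert.hyps by (simp add: add.commute)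
qed

lemma gaussian_tilt_bound:
  fixes y w :: "real^'d"
  assumes y: "norm y = 1" and orth: "y \<bullet> w = 0" and w: "norm w \<le> 1"
    and \<beta>: "0 \<le> \<beta>" "2 * \<beta> + \<beta>\<^sup>2 < 1" and \<delta>: "0 \<le> \<delta>"
  shows "(\<integral>\<^sup>+g. ennreal (exp (\<beta> * (\<Sum>j\<in>UNIV. g j * y $ j)
              * ((\<Sum>j\<in>UNIV. g j * w $ j) - \<delta> * (\<Sum>j\<in>UNIV. g j * y $ j)))) \<partial>PiM UNIV (\<lambda>_. std_normal))
    \<le> ennreal (1 / sqrt (1 + 2 * \<beta> * \<delta> - \<beta>\<^sup>2))"
proof -
  have h: "(\<Sum>j\<in>UNIV. y $ j * w $ j) = 0" using orth by (simp add: inner_vec_def)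
  have w1: "(norm w)\<^sup>2 \<le> 1" using w by (simp add: power_le_one)
  have "\<beta>\<^sup>2 * (norm w)\<^sup>2 \<le> \<beta>\<^sup>2 * 1" using w1 by (intro mult_left_mono) auto
  then have le: "1 + 2 * \<beta> * \<delta> - \<beta>\<^sup>2 \<le> gauss_det \<beta> \<delta> 1 0 ((norm w)\<^sup>2)" by (simp add: gauss_det_def)
  have "0 < 1 - \<beta>\<^sup>2" using \<beta> by simp
  then have pos: "0 < 1 + 2 * \<beta> * \<delta> - \<beta>\<^sup>2" using \<beta> \<delta> by (smt (verit) mult_nonneg_nonneg)
  have "(\<integral>\<^sup>+g. ennreal (exp (\<beta> * (\<Sum>j\<in>UNIV. g j * y $ j)
              * ((\<Sum>j\<in>UNIV. g j * w $ j) - \<delta> * (\<Sum>j\<in>UNIV. g j * y $ j)))) \<partial>PiM UNIV (\<lambda>_. std_normal))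
     = ennreal (1 / sqrt (gauss_det \<beta> \<delta> 1 0 ((norm w)\<^sup>2)))"
    using gaussian_quadratic_mgf[OF finite \<beta> \<delta>, where y = "\<lambda>j. y $ j" and w = "\<lambda>j. w $ j" and p = 0 and s = 0] y w1
    by (simp add: h gauss_form_def flip: power2_norm_vec)
  also have "\<dots> \<le> ennreal (1 / sqrt (1 + 2 * \<beta> * \<delta> - \<beta>\<^sup>2))"
    using le pos by (intro ennreal_leI divide_left_mono) auto
  finally show ?thesis .
qed

section \<open>Matrices with independent entries\<close>

lemma (in prob_space) nn_integral_indep_distr:
  fixes g :: "'d::finite \<Rightarrow> 'a \<Rightarrow> real"
  assumes ind: "indep_vars (\<lambda>_. borel) g UNIV"
    and law: "\<And>j. distr M borel (g j) = N"
    and f[measurable]: "f \<in> borel_measurable (PiM UNIV (\<lambda>_. borel))"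
  shows "(\<integral>\<^sup>+\<omega>. f (\<lambda>j. g j \<omega>) \<partial>M) = (\<integral>\<^sup>+x. f x \<partial>PiM UNIV (\<lambda>_. N))"
proof -
  have [measurable]: "random_variable borel (g j)" for j
    using ind by (auto simp: indep_vars_def)
  have "distr M (PiM UNIV (\<lambda>_. borel)) (\<lambda>\<omega>. \<lambda>j\<in>UNIV. g j \<omega>) = PiM UNIV (\<lambda>j. distr M borel (g j))"
    using ind by (subst (asm) indep_vars_iff_distr_eq_PiM') auto
  then have eq: "PiM UNIV (\<lambda>_. N) = distr M (PiM UNIV (\<lambda>_. borel)) (\<lambda>\<omega> j. g j \<omega>)"
    by (simp add: law restrict_UNIV)
  show ?thesis
    unfolding eq by (rule nn_integral_distr[symmetric]) (auto intro!: measurable_PiM_single')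
qed

lemma (in prob_space) gaussian_row_mgf:
  fixes g :: "'d::finite \<Rightarrow> 'a \<Rightarrow> real" and y w :: "real^'d"
  assumes ind: "indep_vars (\<lambda>_. borel) g UNIV"
    and law: "\<And>j. distributed M lborel (g j) (\<lambda>u. ennreal (std_normal_density u))"
    and y: "norm y = 1" and orth: "y \<bullet> w = 0" and w: "norm w \<le> 1"
    and \<beta>: "0 \<le> \<beta>" "2 * \<beta> + \<beta>\<^sup>2 < 1" and \<delta>: "0 \<le> \<delta>"
  shows "(\<integral>\<^sup>+\<omega>. ennreal (exp (\<beta> * (\<Sum>j\<in>UNIV. g j \<omega> * y $ j)
              * ((\<Sum>j\<in>UNIV. g j \<omega> * w $ j) - \<delta> * (\<Sum>j\<in>UNIV. g j \<omega> * y $ j)))) \<partial>M)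
    \<le> ennreal (1 / sqrt (1 + 2 * \<beta> * \<delta> - \<beta>\<^sup>2))"
proof -
  have "distr M borel (g j) = std_normal" for j
    using distributed_distr_eq_density[OF law[of j]] by (simp cong: distr_cong)
  then show ?thesis
    using gaussian_tilt_bound[OF y orth w \<beta> \<delta>]
    by (subst nn_integral_indep_distr[OF ind, where N = std_normal and
          f = "\<lambda>g. ennreal (exp (\<beta> * (\<Sum>j\<in>UNIV. g j * y $ j)
              * ((\<Sum>j\<in>UNIV. g j * w $ j) - \<delta> * (\<Sum>j\<in>UNIV. g j * y $ j))))"]) auto
qed

lemma (in prob_space) nn_integral_rademacher:
  fixes g :: "'d::finite \<Rightarrow> 'a \<Rightarrow> real" and F :: "real^'d \<Rightarrow> real"
  assumes ind: "indep_vars (\<lambda>_. borel) g UNIV"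
    and pos: "\<And>j. prob {\<omega> \<in> space M. g j \<omega> = 1} = 1 / 2"
    and neg: "\<And>j. prob {\<omega> \<in> space M. g j \<omega> = -1} = 1 / 2"
    and F: "\<And>v. 0 \<le> F v"
  shows "(\<integral>\<^sup>+\<omega>. ennreal (F (\<chi> j. g j \<omega>)) \<partial>M) = ennreal ((\<Sum>\<sigma>\<in>sign_vectors. F \<sigma>) / 2 ^ CARD('d))"
proof -
  have [measurable]: "random_variable borel (g j)" for j
    using ind by (auto simp: indep_vars_def)
  define E where "E \<sigma> = {\<omega> \<in> space M. \<forall>j. g j \<omega> = \<sigma> $ j}" for \<sigma> :: "real^'d"
  have [measurable]: "E \<sigma> \<in> events" for \<sigma> unfolding E_def by measurable
  have E: "prob (E \<sigma>) = 1 / 2 ^ CARD('d)" if "\<sigma> \<in> sign_vectors" for \<sigma>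
  proof -
    have "E \<sigma> = (\<Inter>j\<in>UNIV. g j -` {\<sigma> $ j} \<inter> space M)" by (auto simp: E_def)
    then have "prob (E \<sigma>) = (\<Prod>j\<in>UNIV. prob (g j -` {\<sigma> $ j} \<inter> space M))"
      using indep_varsD_finite[OF ind, of "\<lambda>j. {\<sigma> $ j}"] by simp
    also have "\<dots> = (\<Prod>j\<in>(UNIV :: 'd set). 1 / 2)"
    proof (rule prod.cong[OF refl])
      fix j
      have "g j -` {c} \<inter> space M = {\<omega> \<in> space M. g j \<omega> = c}" for c by auto
      moreover have "\<sigma> $ j = 1 \<or> \<sigma> $ j = -1" using that by (simp add: sign_vectors_def)
      ultimately show "prob (g j -` {\<sigma> $ j} \<inter> space M) = 1 / 2" using pos neg by auto
    qed
    finally show ?thesis by (simp add: power_divide)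
  qed
  have "AE \<omega> in M. g j \<omega> = 1 \<or> g j \<omega> = -1" for j
  proof -
    have "{\<omega> \<in> space M. g j \<omega> = 1 \<or> g j \<omega> = -1} = {\<omega> \<in> space M. g j \<omega> = 1} \<union> {\<omega> \<in> space M. g j \<omega> = -1}"
      by auto
    moreover have "prob ({\<omega> \<in> space M. g j \<omega> = 1} \<union> {\<omega> \<in> space M. g j \<omega> = -1}) = 1"
      using pos[of j] neg[of j] by (subst finite_measure_Union) auto
    ultimately have "prob {\<omega> \<in> space M. g j \<omega> = 1 \<or> g j \<omega> = -1} = 1" by simp
    then show ?thesis by (subst (asm) prob_Collect_eq_1) auto
  qed
  then have AE: "AE \<omega> in M. (\<chi> j. g j \<omega>) \<in> sign_vectors"
    by (simp add: sign_vectors_def AE_all_countable)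
  have "(\<integral>\<^sup>+\<omega>. ennreal (F (\<chi> j. g j \<omega>)) \<partial>M)
      = (\<integral>\<^sup>+\<omega>. (\<Sum>\<sigma>\<in>sign_vectors. ennreal (F \<sigma>) * indicator (E \<sigma>) \<omega>) \<partial>M)"
  proof (rule nn_integral_cong_AE)
    show "AE \<omega> in M. ennreal (F (\<chi> j. g j \<omega>)) = (\<Sum>\<sigma>\<in>sign_vectors. ennreal (F \<sigma>) * indicator (E \<sigma>) \<omega>)"
      using AE AE_space
    proof eventually_elim
      fix \<omega> assume *: "(\<chi> j. g j \<omega>) \<in> sign_vectors" "\<omega> \<in> space M"
      have "(\<Sum>\<sigma>\<in>sign_vectors. ennreal (F \<sigma>) * indicator (E \<sigma>) \<omega>)
         = (\<Sum>\<sigma>\<in>sign_vectors. if \<sigma> = (\<chi> j. g j \<omega>) then ennreal (F \<sigma>) else 0)"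
        using *(2) by (intro sum.cong) (auto simp: E_def vec_eq_iff indicator_def)
      then show "ennreal (F (\<chi> j. g j \<omega>)) = (\<Sum>\<sigma>\<in>sign_vectors. ennreal (F \<sigma>) * indicator (E \<sigma>) \<omega>)"
        using *(1) by (simp add: finite_sign_vectors)
    qed
  qed
  also have "\<dots> = (\<Sum>\<sigma>\<in>sign_vectors. ennreal (F \<sigma>) * emeasure M (E \<sigma>))"
    by (subst nn_integral_sum) (auto simp: nn_integral_cmult_indicator)
  also have "\<dots> = (\<Sum>\<sigma>\<in>sign_vectors. ennreal (F \<sigma> / 2 ^ CARD('d)))"
    using F by (intro sum.cong refl) (simp add: emeasure_eq_measure E flip: ennreal_mult)
  also have "\<dots> = ennreal ((\<Sum>\<sigma>\<in>sign_vectors. F \<sigma>) / 2 ^ CARD('d))"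
    using F by (subst sum_ennreal) (auto simp: sum_divide_distrib)
  finally show ?thesis .
qed

lemma (in prob_space) rademacher_row_mgf:
  fixes g :: "'d::finite \<Rightarrow> 'a \<Rightarrow> real" and y w :: "real^'d"
  assumes ind: "indep_vars (\<lambda>_. borel) g UNIV"
    and pos: "\<And>j. prob {\<omega> \<in> space M. g j \<omega> = 1} = 1 / 2"
    and neg: "\<And>j. prob {\<omega> \<in> space M. g j \<omega> = -1} = 1 / 2"
    and tilt: "norm y = 1" "y \<bullet> w = 0" "norm w \<le> 1" "0 \<le> b"
      "\<beta>\<^sup>2 * (1 / 2 + \<delta>\<^sup>2) \<le> b\<^sup>2" "2 * b < 1"
  shows "(\<integral>\<^sup>+\<omega>. ennreal (exp (\<beta> * (\<Sum>j\<in>UNIV. g j \<omega> * y $ j)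
              * ((\<Sum>j\<in>UNIV. g j \<omega> * w $ j) - \<delta> * (\<Sum>j\<in>UNIV. g j \<omega> * y $ j)))) \<partial>M)
    \<le> ennreal (exp (- (\<beta> * \<delta>) - b - ln (1 - 2 * b) / 2))"
proof -
  define F where "F \<sigma> = exp (\<beta> * (\<sigma> \<bullet> y) * (\<sigma> \<bullet> w - \<delta> * (\<sigma> \<bullet> y)))" for \<sigma> :: "real^'d"
  have "(\<integral>\<^sup>+\<omega>. ennreal (F (\<chi> j. g j \<omega>)) \<partial>M) = ennreal ((\<Sum>\<sigma>\<in>sign_vectors. F \<sigma>) / 2 ^ CARD('d))"
    by (rule nn_integral_rademacher[OF ind pos neg]) (simp add: F_def)
  also have "\<dots> \<le> ennreal (exp (- (\<beta> * \<delta>) - b - ln (1 - 2 * b) / 2))"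
    unfolding F_def by (intro ennreal_leI rademacher_tilt_bound tilt)
  finally show ?thesis by (simp add: F_def inner_vec_def)
qed

text \<open>Chernoff's method for the rows. The exponents of the rows add up to
  \<open>c (\<langle>Ay, Aw\<rangle> - \<delta> \<parallel>Ay\<parallel>\<^sup>2)\<close>, so the exponential is at least one on the event in question and its mean
  factorises over the rows.\<close>

lemma (in prob_space) independent_rows_tail:
  fixes A :: "'a \<Rightarrow> real^'d^'n" and y w :: "real^'d"
  assumes ind: "indep_vars (\<lambda>_. borel) (\<lambda>(i, j) \<omega>. A \<omega> $ i $ j) UNIV"
    and mgf: "\<And>i. (\<integral>\<^sup>+\<omega>. ennreal (exp (c * (A \<omega> *v y) $ i * ((A \<omega> *v w) $ i - \<delta> * (A \<omega> *v y) $ i))) \<partial>M)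
      \<le> ennreal (exp (- \<theta>))"
    and c: "0 \<le> c"
  shows "prob {\<omega> \<in> space M. \<delta> * (norm (A \<omega> *v y))\<^sup>2 \<le> (A \<omega> *v y) \<bullet> (A \<omega> *v w)}
    \<le> exp (- \<theta> * real CARD('n))"
proof -
  have rv[measurable]: "(\<lambda>\<omega>. A \<omega> $ i $ j) \<in> borel_measurable M" for i j
    using ind by (auto simp: indep_vars_def dest!: bspec[of _ _ "(i, j)"])
  have [measurable]: "(\<lambda>\<omega>. (A \<omega> *v v) $ i) \<in> borel_measurable M" for v i
    by (simp add: matrix_vector_mult_def)
  define Z where "Z i \<omega> = exp (c * (A \<omega> *v y) $ i * ((A \<omega> *v w) $ i - \<delta> * (A \<omega> *v y) $ i))" for i \<omega>
  have [measurable]: "Z i \<in> borel_measurable M" for i unfolding Z_def by measurable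
  define H where "H i x = exp (c * (\<Sum>j\<in>UNIV. x (i, j) * y $ j)
     * ((\<Sum>j\<in>UNIV. x (i, j) * w $ j) - \<delta> * (\<Sum>j\<in>UNIV. x (i, j) * y $ j)))" for i and x :: "'n \<times> 'd \<Rightarrow> real"
  have "indep_vars (\<lambda>i. PiM ({i} \<times> UNIV) (\<lambda>_. borel))
      (\<lambda>i \<omega>. restrict (\<lambda>ij. (case ij of (i, j) \<Rightarrow> \<lambda>\<omega>. A \<omega> $ i $ j) \<omega>) ({i} \<times> UNIV)) UNIV"
    by (rule indep_vars_restrict[OF ind]) (auto simp: disjoint_family_on_def)
  then have "indep_vars (\<lambda>_. borel) (\<lambda>i \<omega>. H i (restrict (\<lambda>ij. (case ij of (i, j) \<Rightarrow> \<lambda>\<omega>. A \<omega> $ i $ j) \<omega>) ({i} \<times> UNIV))) UNIV"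
    by (rule indep_vars_compose2) (simp add: H_def)
  then have indZ: "indep_vars (\<lambda>_. borel) Z UNIV"
    by (rule indep_vars_cong[THEN iffD1, rotated -1])
       (auto simp: H_def Z_def matrix_vector_mult_def)
  have prodZ: "(\<Prod>i\<in>UNIV. Z i \<omega>) = exp (c * ((A \<omega> *v y) \<bullet> (A \<omega> *v w) - \<delta> * (norm (A \<omega> *v y))\<^sup>2))" for \<omega>
  proof -
    have "(\<Prod>i\<in>UNIV. Z i \<omega>) = exp (\<Sum>i\<in>UNIV. c * (A \<omega> *v y) $ i * ((A \<omega> *v w) $ i - \<delta> * (A \<omega> *v y) $ i))"
      by (simp add: Z_def exp_sum)
    also have "(\<Sum>i\<in>UNIV. c * (A \<omega> *v y) $ i * ((A \<omega> *v w) $ i - \<delta> * (A \<omega> *v y) $ i))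
      = c * ((A \<omega> *v y) \<bullet> (A \<omega> *v w) - \<delta> * (norm (A \<omega> *v y))\<^sup>2)"
      unfolding power2_norm_vec inner_vec_def inner_real_def power2_eq_square[of "(_ :: real^'n) $ _"]
      by (simp add: sum_distrib_left sum_subtractf right_diff_distrib mult_ac)
    finally show ?thesis .
  qed
  have "emeasure M {\<omega> \<in> space M. \<delta> * (norm (A \<omega> *v y))\<^sup>2 \<le> (A \<omega> *v y) \<bullet> (A \<omega> *v w)}
    \<le> emeasure M {\<omega> \<in> space M. 1 \<le> 1 * (\<Prod>i\<in>UNIV. ennreal (Z i \<omega>))}"
  proof (rule emeasure_mono)
    show "{\<omega> \<in> space M. \<delta> * (norm (A \<omega> *v y))\<^sup>2 \<le> (A \<omega> *v y) \<bullet> (A \<omega> *v w)}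
      \<subseteq> {\<omega> \<in> space M. 1 \<le> 1 * (\<Prod>i\<in>UNIV. ennreal (Z i \<omega>))}"
    proof safe
      fix \<omega> assume "\<delta> * (norm (A \<omega> *v y))\<^sup>2 \<le> (A \<omega> *v y) \<bullet> (A \<omega> *v w)"
      then have "1 \<le> (\<Prod>i\<in>UNIV. Z i \<omega>)" unfolding prodZ using c by simp
      moreover have "(\<Prod>i\<in>UNIV. ennreal (Z i \<omega>)) = ennreal (\<Prod>i\<in>UNIV. Z i \<omega>)"
        by (rule prod_ennreal) (simp add: Z_def)
      ultimately show "1 \<le> 1 * (\<Prod>i\<in>UNIV. ennreal (Z i \<omega>))" by simp
    qed
  qed measurable
  also have "\<dots> \<le> 1 * (\<integral>\<^sup>+\<omega>. (\<Prod>i\<in>UNIV. ennreal (Z i \<omega>)) * indicator (space M) \<omega> \<partial>M)"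
    by (rule nn_integral_Markov_inequality) measurable
  also have "\<dots> = (\<integral>\<^sup>+\<omega>. (\<Prod>i\<in>UNIV. ennreal (Z i \<omega>)) \<partial>M)"
    unfolding mult_1 by (rule nn_integral_cong) simp
  also have "\<dots> = (\<Prod>i\<in>UNIV. \<integral>\<^sup>+\<omega>. ennreal (Z i \<omega>) \<partial>M)"
  proof (rule indep_vars_nn_integral)
    show "indep_vars (\<lambda>_. borel) (\<lambda>i \<omega>. ennreal (Z i \<omega>)) UNIV"
      by (rule indep_vars_compose2[OF indZ]) simp
  qed auto
  also have "\<dots> \<le> (\<Prod>i\<in>(UNIV :: 'n set). ennreal (exp (- \<theta>)))"
    using mgf by (intro prod_mono_ennreal) (simp add: Z_def)
  also have "\<dots> = ennreal (exp (- \<theta> * real CARD('n)))"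
    by (simp add: ennreal_power exp_of_nat_mult[symmetric] mult.commute)
  finally show ?thesis by (simp add: emeasure_eq_measure)
qed

section \<open>Comparison of the exponents and numerical bounds\<close>

text \<open>The rate is \<open>\<delta>\<^sup>2 / (C\<^sub>1 + C\<^sub>2 \<delta>)\<close> with the constants rounded down, which makes it strictly
  larger.\<close>

abbreviation tail_rate :: "real \<Rightarrow> real" where
  "tail_rate \<delta> \<equiv> \<delta>\<^sup>2 / (2504 / 1000 + 3844 / 1000 * \<delta>)"

lemma exp_1_bounds: "2718281 / 1000000 < exp (1::real)" "exp (1::real) < 2718283 / 1000000"
proof -
  obtain t where t: "\<bar>t\<bar> \<le> \<bar>1::real\<bar>" "exp 1 = (\<Sum>m<11. 1 ^ m / fact m) + exp t / fact 11 * 1 ^ 11"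
    using Maclaurin_exp_le[of 1 11] by blast
  have "exp t \<le> exp 1" using t(1) by simp
  then have "exp t \<le> 3" using exp_le by linarith
  moreover have "0 < exp t" by simp
  moreover have "(\<Sum>m<11. 1 ^ m / fact m) = (9864101 / 3628800 :: real)"
    by (simp add: fact_numeral lessThan_nat_numeral)
  moreover have "fact 11 = (39916800 :: real)" by (simp add: fact_numeral)
  ultimately show "2718281 / 1000000 < exp (1::real)" "exp (1::real) < 2718283 / 1000000"
    using t(2) by (simp_all only: power_one mult_1_right)
qed

text \<open>The logarithmic series with its tail, from the cubic term on, dominated by a geometric series.\<close>

lemma neg_ln_one_minus_le:
  fixes x :: real
  assumes "0 \<le> x" "x < 1"
  shows "- ln (1 - x) \<le> x + x\<^sup>2 / 2 + x ^ 3 / (3 * (1 - x))"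
proof -
  define f where "f u = u + u\<^sup>2 / 2 + u ^ 3 / (3 * (1 - u)) + ln (1 - u)" for u :: real
  have "f 0 \<le> f x"
  proof (rule DERIV_nonneg_imp_nondecreasing[OF assms(1)])
    fix u :: real assume u: "0 \<le> u" "u \<le> x"
    have u1: "1 - u > 0" using u assms by simp
    have d: "(f has_real_derivative (1 + u + (3 * u\<^sup>2 * (3 * (1 - u)) + u ^ 3 * 3) / (3 * (1 - u))\<^sup>2 - 1 / (1 - u))) (at u)"
      unfolding f_def using u1
      by (auto intro!: derivative_eq_intros simp: power2_eq_square)
    define v where "v = 1 - u"
    have v: "v > 0" and uv: "u = 1 - v" using u1 by (auto simp: v_def)
    have "1 + u + (3 * u\<^sup>2 * (3 * (1 - u)) + u ^ 3 * 3) / (3 * (1 - u))\<^sup>2 - 1 / (1 - u) = u ^ 3 / (3 * (1 - u)\<^sup>2)"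
      unfolding uv using v by (simp add: field_simps power2_eq_square power3_eq_cube)
    then show "\<exists>y. (f has_real_derivative y) (at u) \<and> 0 \<le> y"
      using d u by (intro exI[of _ "u ^ 3 / (3 * (1 - u)\<^sup>2)"] conjI) auto
  qed
  then show ?thesis by (simp add: f_def)
qed

text \<open>Here \<open>b\<close> replaces \<open>\<beta> (1/2 + \<delta>\<^sup>2)\<^sup>1\<^sup>/\<^sup>2\<close>, with the square root majorised by the linear function
  \<open>0.71 + 0.32 \<delta>\<close> on \<open>0 \<le> \<delta> \<le> 1/2\<close>. The logarithm is bounded by \<open>neg_ln_one_minus_le\<close>, with
  its cubic tail estimated through \<open>p\<^sup>3 / (u - 2 \<delta> p) \<le> 0.41\<close>. What remains are inequalities between
  polynomials in \<open>\<delta>\<close>, which follow from \<open>\<delta>\<^sup>2 \<le> \<delta> / 2\<close> and \<open>\<delta>\<^sup>3 \<le> \<delta> / 4\<close>.\<close>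

lemma rademacher_exponent:
  fixes \<delta> :: real
  assumes \<delta>: "0 < \<delta>" "\<delta> \<le> 1 / 2"
  defines "\<beta> \<equiv> \<delta> / (1 + 3 * \<delta>)" and "b \<equiv> \<delta> * (71 / 100 + 32 / 100 * \<delta>) / (1 + 3 * \<delta>)"
  shows "\<beta>\<^sup>2 * (1 / 2 + \<delta>\<^sup>2) \<le> b\<^sup>2" and "2 * b < 1"
    and "- (\<beta> * \<delta>) - b - ln (1 - 2 * b) / 2 \<le> - (tail_rate \<delta>)"
proof -
  define p u where "p = 71 / 100 + 32 / 100 * \<delta>" and "u = 1 + 3 * \<delta>"
  have pu: "p > 0" "u > 0" using \<delta> by (auto simp: p_def u_def)
  have d2: "0 \<le> \<delta>\<^sup>2" "\<delta>\<^sup>2 \<le> \<delta> / 2" using \<delta> by (auto simp: power2_eq_square)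
  have d3: "\<delta> ^ 3 \<le> \<delta> / 4"
    using mult_mono[OF d2(2) \<delta>(2)] \<delta> by (simp add: power3_eq_cube power2_eq_square)
  have b: "b = \<delta> * p / u" and \<beta>: "\<beta> = \<delta> / u" by (simp_all add: b_def \<beta>_def p_def u_def)
  have psq: "p\<^sup>2 = 5041 / 10000 + 4544 / 10000 * \<delta> + 1024 / 10000 * \<delta>\<^sup>2"
    by (simp add: p_def power2_eq_square algebra_simps)
  then have "1 / 2 + \<delta>\<^sup>2 \<le> p\<^sup>2" using \<delta> d2 by linarith
  then have "(\<delta> / u)\<^sup>2 * (1 / 2 + \<delta>\<^sup>2) \<le> (\<delta> / u)\<^sup>2 * p\<^sup>2" by (intro mult_left_mono) auto
  then show "\<beta>\<^sup>2 * (1 / 2 + \<delta>\<^sup>2) \<le> b\<^sup>2" by (simp add: b \<beta> power_mult_distrib power_divide)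
  have v: "u - 2 * \<delta> * p \<ge> 1 + 126 / 100 * \<delta>"
  proof -
    have "u - 2 * \<delta> * p = 1 + 158 / 100 * \<delta> - 64 / 100 * \<delta>\<^sup>2"
      by (simp add: p_def u_def power2_eq_square algebra_simps)
    then show ?thesis using d2 by linarith
  qed
  then have v0: "u - 2 * \<delta> * p > 0" using \<delta> by simp
  then show b1: "2 * b < 1" using pu by (simp add: b field_simps)
  have b0: "0 \<le> b" using pu \<delta> by (simp add: b)
  have "- ln (1 - 2 * b) \<le> 2 * b + (2 * b)\<^sup>2 / 2 + (2 * b) ^ 3 / (3 * (1 - 2 * b))"
    by (rule neg_ln_one_minus_le) (use b0 b1 in auto)
  then have 1: "- b - ln (1 - 2 * b) / 2 \<le> b\<^sup>2 + 4 / 3 * b ^ 3 / (1 - 2 * b)"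
    by (simp add: power_mult_distrib field_simps)
  have p3: "p ^ 3 \<le> 41 / 100 * (u - 2 * \<delta> * p)"
  proof -
    have "p ^ 3 = 357911 / 1000000 + 483936 / 1000000 * \<delta> + 218112 / 1000000 * \<delta>\<^sup>2 + 32768 / 1000000 * \<delta> ^ 3"
      by (simp add: p_def power3_eq_cube power2_eq_square algebra_simps)
    then have "p ^ 3 \<le> 41 / 100 + 5166 / 10000 * \<delta>" using \<delta> d2 d3 by linarith
    also have "\<dots> = 41 / 100 * (1 + 126 / 100 * \<delta>)" by simp
    finally have "p ^ 3 \<le> 41 / 100 * (1 + 126 / 100 * \<delta>)" .
    then show ?thesis using v by simp
  qed
  have e: "4 / 3 * b ^ 3 / (1 - 2 * b) = \<delta> ^ 3 / u\<^sup>2 * (4 / 3 * (p ^ 3 / (u - 2 * \<delta> * p)))"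
    using pu v0 by (simp add: b field_simps power2_eq_square power3_eq_cube)
  have "p ^ 3 / (u - 2 * \<delta> * p) \<le> 41 / 100" using p3 v0 by (simp add: field_simps)
  then have "4 / 3 * (p ^ 3 / (u - 2 * \<delta> * p)) \<le> 547 / 1000" by linarith
  then have 2: "4 / 3 * b ^ 3 / (1 - 2 * b) \<le> \<delta> ^ 3 / u\<^sup>2 * (547 / 1000)"
    unfolding e by (rule mult_left_mono) (use \<delta> in auto)
  have p2: "p\<^sup>2 \<le> 5041 / 10000 + 5056 / 10000 * \<delta>" using d2 psq by linarith
  have "u\<^sup>2 \<le> (4959 / 10000 + 1947 / 1000 * \<delta>) * (2504 / 1000 + 3844 / 1000 * \<delta>)"
  proof -
    have "u\<^sup>2 = 1 + 6 * \<delta> + 9 * \<delta>\<^sup>2" by (simp add: u_def power2_eq_square algebra_simps)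
    moreover have "(4959 / 10000 + 1947 / 1000 * \<delta>) * (2504 / 1000 + 3844 / 1000 * \<delta>)
      = 12417336 / 10000000 + 67815276 / 10000000 * \<delta> + 7484268 / 1000000 * \<delta>\<^sup>2"
      by (simp add: power2_eq_square algebra_simps)
    ultimately show ?thesis using d2 \<delta> by linarith
  qed
  then have "u\<^sup>2 / (2504 / 1000 + 3844 / 1000 * \<delta>) \<le> 4959 / 10000 + 1947 / 1000 * \<delta>" using \<delta> by (simp add: pos_divide_le_eq)
  also have "\<dots> \<le> u - p\<^sup>2 - 547 / 1000 * \<delta>" using p2 \<delta> by (simp add: u_def)
  finally have "\<delta>\<^sup>2 / u\<^sup>2 * (u\<^sup>2 / (2504 / 1000 + 3844 / 1000 * \<delta>)) \<le> \<delta>\<^sup>2 / u\<^sup>2 * (u - p\<^sup>2 - 547 / 1000 * \<delta>)"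
    by (intro mult_left_mono) auto
  moreover have "\<delta>\<^sup>2 / u\<^sup>2 * (u - p\<^sup>2 - 547 / 1000 * \<delta>) = \<beta> * \<delta> - b\<^sup>2 - \<delta> ^ 3 / u\<^sup>2 * (547 / 1000)"
    using pu by (simp add: b \<beta> power2_eq_square power3_eq_cube field_simps)
  moreover have "\<delta>\<^sup>2 / u\<^sup>2 * (u\<^sup>2 / (2504 / 1000 + 3844 / 1000 * \<delta>)) = tail_rate \<delta>"
    using pu by simp
  ultimately have 3: "tail_rate \<delta> \<le> \<beta> * \<delta> - b\<^sup>2 - \<delta> ^ 3 / u\<^sup>2 * (547 / 1000)"
    by metis
  show "- (\<beta> * \<delta>) - b - ln (1 - 2 * b) / 2 \<le> - (tail_rate \<delta>)"
    using 1 2 3 by linarith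
qed

text \<open>Since \<open>ln (1 + z) \<ge> z / (1 + z)\<close>, it suffices to compare the rate with \<open>z / (2 (1 + z))\<close> for
  \<open>z = 2 \<beta> \<delta> - \<beta>\<^sup>2 = \<delta>\<^sup>2 (1 + 6 \<delta>) / (1 + 3 \<delta>)\<^sup>2\<close>.\<close>

lemma gaussian_exponent:
  fixes \<delta> :: real
  assumes \<delta>: "0 < \<delta>" "\<delta> \<le> 1 / 2"
  defines "\<beta> \<equiv> \<delta> / (1 + 3 * \<delta>)"
  shows "2 * \<beta> + \<beta>\<^sup>2 < 1"
    and "1 / sqrt (1 + 2 * \<beta> * \<delta> - \<beta>\<^sup>2) \<le> exp (- (tail_rate \<delta>))"
proof -
  define u where "u = 1 + 3 * \<delta>"
  have u: "u > 0" using \<delta> by (simp add: u_def)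
  have d2: "0 \<le> \<delta>\<^sup>2" "\<delta>\<^sup>2 \<le> \<delta> / 2" using \<delta> by (auto simp: power2_eq_square)
  have \<beta>0: "0 < \<beta>" "\<beta> < 1 / 3" using \<delta> by (auto simp: \<beta>_def field_simps)
  have "\<beta>\<^sup>2 < (1 / 3)\<^sup>2" using \<beta>0 by (intro power_strict_mono) auto
  then show "2 * \<beta> + \<beta>\<^sup>2 < 1" using \<beta>0 by (simp add: power2_eq_square)
  define z where "z = \<delta>\<^sup>2 * (1 + 6 * \<delta>) / u\<^sup>2"
  have z0: "0 < z" using \<delta> u by (simp add: z_def)
  have z: "1 + 2 * \<beta> * \<delta> - \<beta>\<^sup>2 = 1 + z"
  proof -
    have "2 * (\<delta> / u) * \<delta> - (\<delta> / u)\<^sup>2 = \<delta>\<^sup>2 * (2 * u - 1) / u\<^sup>2"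
      using u by (simp add: field_simps power2_eq_square)
    then show ?thesis by (simp add: z_def \<beta>_def u_def)
  qed
  have d3: "12 * \<delta> ^ 3 \<le> 6 * \<delta>\<^sup>2"
    using mult_right_mono[OF \<delta>(2) d2(1)] by (simp add: power3_eq_cube power2_eq_square)
  have "2 * (u\<^sup>2 + \<delta>\<^sup>2 * (1 + 6 * \<delta>)) \<le> (1 + 6 * \<delta>) * (2504 / 1000 + 3844 / 1000 * \<delta>)"
  proof -
    have "2 * (u\<^sup>2 + \<delta>\<^sup>2 * (1 + 6 * \<delta>)) = 2 + 12 * \<delta> + 20 * \<delta>\<^sup>2 + 12 * \<delta> ^ 3"
      by (simp add: u_def power2_eq_square power3_eq_cube algebra_simps)
    moreover have "(1 + 6 * \<delta>) * (2504 / 1000 + 3844 / 1000 * \<delta>) = 2504 / 1000 + 18868 / 1000 * \<delta> + 23064 / 1000 * \<delta>\<^sup>2"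
      by (simp add: power2_eq_square field_simps)
    ultimately show ?thesis using \<delta> d2 d3 by linarith
  qed
  then have "\<delta>\<^sup>2 * (2 * (u\<^sup>2 + \<delta>\<^sup>2 * (1 + 6 * \<delta>))) \<le> \<delta>\<^sup>2 * ((1 + 6 * \<delta>) * (2504 / 1000 + 3844 / 1000 * \<delta>))"
    by (intro mult_left_mono) auto
  moreover have "0 < u\<^sup>2 + \<delta>\<^sup>2 * (1 + 6 * \<delta>)" using u \<delta> by (intro add_pos_pos) auto
  ultimately have k: "tail_rate \<delta> \<le> \<delta>\<^sup>2 * (1 + 6 * \<delta>) / (2 * (u\<^sup>2 + \<delta>\<^sup>2 * (1 + 6 * \<delta>)))"
    using \<delta> by (subst frac_le_eq) (simp_all add: divide_nonpos_pos mult.assoc)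
  have "z / (1 + z) = \<delta>\<^sup>2 * (1 + 6 * \<delta>) / (u\<^sup>2 + \<delta>\<^sup>2 * (1 + 6 * \<delta>))"
  proof -
    have "u\<^sup>2 * (1 + z) = u\<^sup>2 + \<delta>\<^sup>2 * (1 + 6 * \<delta>)" using u by (simp add: z_def field_simps)
    moreover have "u\<^sup>2 * z = \<delta>\<^sup>2 * (1 + 6 * \<delta>)" using u by (simp add: z_def)
    ultimately show ?thesis using u by (metis mult_divide_mult_cancel_left power_not_zero less_irrefl)
  qed
  then have k2: "tail_rate \<delta> \<le> z / (1 + z) / 2" using k by (simp add: algebra_simps)
  have "ln (1 / (1 + z)) \<le> 1 / (1 + z) - 1" using z0 by (intro ln_le_minus_one) auto
  also have "\<dots> = - (z / (1 + z))" using z0 by (simp add: field_simps)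
  finally have "z / (1 + z) \<le> ln (1 + z)" using z0 by (simp add: ln_div)
  then have "z / (1 + z) / 2 \<le> ln (1 + z) / 2" by (rule divide_right_mono) simp
  moreover have "ln (sqrt (1 + z)) = ln (1 + z) / 2" using z0 by (simp add: ln_sqrt)
  ultimately have "tail_rate \<delta> \<le> ln (sqrt (1 + z))"
    using order_trans[OF k2] by metis
  then have "exp (- ln (sqrt (1 + z))) \<le> exp (- (tail_rate \<delta>))" by simp
  then show "1 / sqrt (1 + 2 * \<beta> * \<delta> - \<beta>\<^sup>2) \<le> exp (- (tail_rate \<delta>))"
    unfolding z exp_minus using z0 by (subst (asm) exp_ln) (auto simp: inverse_eq_divide)
qed

lemma arctan_taylor_bounds:
  fixes x :: real
  assumes "0 \<le> x"
  shows "arctan x \<le> x - x ^ 3 / 3 + x ^ 5 / 5" and "x - x ^ 3 / 3 + x ^ 5 / 5 - x ^ 7 / 7 \<le> arctan x"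
proof -
  have nz: "1 + u\<^sup>2 > 0" for u :: real by (simp add: add_pos_nonneg)
  have "(\<lambda>u. u - u ^ 3 / 3 + u ^ 5 / 5 - arctan u) 0 \<le> (\<lambda>u. u - u ^ 3 / 3 + u ^ 5 / 5 - arctan u) x"
  proof (rule DERIV_nonneg_imp_nondecreasing[OF assms])
    fix u :: real
    have "((\<lambda>u. u - u ^ 3 / 3 + u ^ 5 / 5 - arctan u) has_real_derivative 1 - u\<^sup>2 + u ^ 4 - inverse (1 + u\<^sup>2)) (at u)"
      by (auto intro!: derivative_eq_intros)
    moreover have e: "1 - u\<^sup>2 + u ^ 4 - inverse (1 + u\<^sup>2) = u ^ 6 / (1 + u\<^sup>2)"
    proof -
      have "inverse (1 + u\<^sup>2) * (1 + u\<^sup>2) = 1" using nz[of u] by simp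
      moreover have "(1 - u\<^sup>2 + u ^ 4) * (1 + u\<^sup>2) = 1 + u ^ 6"
        by (simp add: algebra_simps flip: power_add)
      ultimately show ?thesis
        using nz[of u] by (simp only: eq_divide_eq left_diff_distrib[where c = "1 + u\<^sup>2"]) simp
    qed
    moreover have "0 \<le> u ^ 6 / (1 + u\<^sup>2)" using nz[of u] by (intro divide_nonneg_pos zero_le_even_power) auto
    ultimately show "\<exists>D. ((\<lambda>u. u - u ^ 3 / 3 + u ^ 5 / 5 - arctan u) has_real_derivative D) (at u) \<and> 0 \<le> D"
      unfolding e by blast
  qed
  then show "arctan x \<le> x - x ^ 3 / 3 + x ^ 5 / 5" by simp
  have "(\<lambda>u. arctan u - (u - u ^ 3 / 3 + u ^ 5 / 5 - u ^ 7 / 7)) 0 \<le> (\<lambda>u. arctan u - (u - u ^ 3 / 3 + u ^ 5 / 5 - u ^ 7 / 7)) x"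
  proof (rule DERIV_nonneg_imp_nondecreasing[OF assms])
    fix u :: real
    have "((\<lambda>u. arctan u - (u - u ^ 3 / 3 + u ^ 5 / 5 - u ^ 7 / 7)) has_real_derivative inverse (1 + u\<^sup>2) - (1 - u\<^sup>2 + u ^ 4 - u ^ 6)) (at u)"
      by (auto intro!: derivative_eq_intros)
    moreover have e: "inverse (1 + u\<^sup>2) - (1 - u\<^sup>2 + u ^ 4 - u ^ 6) = u ^ 8 / (1 + u\<^sup>2)"
    proof -
      have "inverse (1 + u\<^sup>2) * (1 + u\<^sup>2) = 1" using nz[of u] by simp
      moreover have "(1 - u\<^sup>2 + u ^ 4 - u ^ 6) * (1 + u\<^sup>2) = 1 - u ^ 8"
        by (simp add: algebra_simps flip: power_add)
      ultimately show ?thesis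
        using nz[of u] by (simp only: eq_divide_eq left_diff_distrib[where c = "1 + u\<^sup>2"]) simp
    qed
    moreover have "0 \<le> u ^ 8 / (1 + u\<^sup>2)" using nz[of u] by (intro divide_nonneg_pos zero_le_even_power) auto
    ultimately show "\<exists>D. ((\<lambda>u. arctan u - (u - u ^ 3 / 3 + u ^ 5 / 5 - u ^ 7 / 7)) has_real_derivative D) (at u) \<and> 0 \<le> D"
      unfolding e by blast
  qed
  then show "x - x ^ 3 / 3 + x ^ 5 / 5 - x ^ 7 / 7 \<le> arctan x" by simp
qed

text \<open>Machin's formula \<open>\<pi> / 4 = 4 arctan (1/5) - arctan (1/239)\<close>.\<close>

lemma pi_bounds: "314159 / 100000 < pi" "pi < 314163 / 100000"
proof -
  have "arctan (1 / 5) \<le> 1973974 / 10000000" "1973955 / 10000000 \<le> arctan (1 / 5)"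
    using arctan_taylor_bounds[of "1 / 5"] by (simp_all add: field_simps)
  moreover have "arctan (1 / 239) \<le> 41842 / 10000000" "41840 / 10000000 \<le> arctan (1 / 239)"
    using arctan_taylor_bounds[of "1 / 239"] by (simp_all add: field_simps)
  ultimately show "314159 / 100000 < pi" "pi < 314163 / 100000" using machin by simp_all
qed

lemma C1_bounds: "250435 / 100000 < C1" "C1 < 250445 / 100000"
proof -
  have e: "271828 / 100000 < exp (1 :: real)" "exp (1 :: real) < 271829 / 100000"
    using exp_1_bounds by simp_all
  have s0: "0 < sqrt (6 * pi)" by simp
  have "250435 / 100000 * sqrt (6 * pi) < 250435 / 100000 * (434168 / 100000)"
    using pi_bounds by (intro mult_strict_left_mono real_less_lsqrt) (auto simp: power2_eq_square)
  also have "\<dots> < 4 * exp 1" using e by simp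
  finally show "250435 / 100000 < C1" using s0 by (simp add: C1_def pos_less_divide_eq)
  have "4 * exp 1 < 250445 / 100000 * (434155 / 100000 :: real)" using e by simp
  also have "\<dots> < 250445 / 100000 * sqrt (6 * pi)"
    using pi_bounds by (intro mult_strict_left_mono real_less_rsqrt) (auto simp: power2_eq_square)
  finally show "C1 < 250445 / 100000" using s0 by (simp add: C1_def pos_divide_less_eq)
qed

lemma C2_bounds: "384415 / 100000 < C2" "C2 < 384425 / 100000"
proof -
  have s: "1414213 / 1000000 < sqrt 2" by (rule real_less_rsqrt) (simp add: power2_eq_square)
  have s': "sqrt 2 < 1414214 / 1000000" by (rule real_less_lsqrt) (auto simp: power2_eq_square)
  have "2718281 / 1000000 * (1414213 / 1000000) < exp 1 * sqrt 2"
    by (rule mult_strict_mono[OF exp_1_bounds(1) s]) simp_all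
  moreover have "384415 / 100000 < 2718281 / 1000000 * (1414213 / 1000000 :: real)" by simp
  ultimately show "384415 / 100000 < C2" unfolding C2_def by (rule less_trans[rotated])
  have "exp 1 * sqrt 2 < 2718283 / 1000000 * (1414214 / 1000000)"
    by (rule mult_strict_mono[OF exp_1_bounds(2) s']) simp_all
  moreover have "2718283 / 1000000 * (1414214 / 1000000 :: real) < 384425 / 100000" by simp
  ultimately show "C2 < 384425 / 100000" unfolding C2_def by (rule less_trans)
qed

section \<open>Thresholding and deviations of the measured correlations\<close>

text \<open>A competing index set of the same size misses some index of \<open>L\<close> and contains one outside \<open>L\<close>, in
  the wrong order.\<close>

lemma thresholding_supports_unique:
  fixes \<Psi> :: "real^'k^'n"
  assumes sep: "\<And>i k. i \<in> L \<Longrightarrow> k \<notin> L \<Longrightarrow> \<bar>s \<bullet> column k \<Psi>\<bar> < \<bar>s \<bullet> column i \<Psi>\<bar>"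
  shows "thresholding_supports \<Psi> (card L) s = {L}"
proof (rule set_eqI, rule iffI)
  fix L' assume "L' \<in> thresholding_supports \<Psi> (card L) s"
  then have c: "card L' = card L" and le: "\<And>i k. i \<in> L' \<Longrightarrow> k \<notin> L' \<Longrightarrow> \<bar>s \<bullet> column k \<Psi>\<bar> \<le> \<bar>s \<bullet> column i \<Psi>\<bar>"
    by (auto simp: thresholding_supports_def)
  show "L' \<in> {L}"
  proof (rule ccontr)
    assume "L' \<notin> {L}"
    then have "\<not> L \<subseteq> L'" "\<not> L' \<subseteq> L" using c card_subset_eq[of L' L] card_subset_eq[of L L'] by auto
    then obtain i k where "i \<in> L" "i \<notin> L'" "k \<in> L'" "k \<notin> L" by blast
    then show False using sep[of i k] le[of k i] by simp
  qed
qed (use sep in \<open>auto simp: thresholding_supports_def intro: less_imp_le\<close>)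

text \<open>The rows of the pseudo-inverse outside \<open>L\<close> vanish because \<open>X = X B X = B\<^sup>T X\<^sup>T X\<close>, and \<open>B X B = B\<close> shows that
  the output explains the measurements.\<close>

lemma pseudo_inverse_restrict_columns_recovers:
  fixes \<Psi> :: "real^'k^'n"
  assumes "support x \<subseteq> L"
  defines "x' \<equiv> pseudo_inverse (restrict_columns L \<Psi>) *v (\<Psi> *v x)"
  shows "support x' \<subseteq> L" and "\<Psi> *v x' = \<Psi> *v x"
proof -
  let ?B = "restrict_columns L \<Psi>"
  let ?X = "pseudo_inverse ?B"
  have restrict: "?B *v z = \<Psi> *v z" if "support z \<subseteq> L" for z
    using that unfolding restrict_columns_def matrix_vector_mult_def support_def vec_eq_iff
    by (auto intro!: sum.cong)
  have P: "?B ** ?X ** ?B = ?B" "?X ** ?B ** ?X = ?X" "transpose (?X ** ?B) = ?X ** ?B"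
    using penrose_pseudo_inverse[of ?B] by (auto simp: penrose_def)
  have "?X = transpose ?B ** (transpose ?X ** ?X)"
    using P(2,3) by (metis matrix_mul_assoc matrix_transpose_mul)
  then have x': "x' = transpose ?B *v ((transpose ?X ** ?X) *v (\<Psi> *v x))"
    unfolding x'_def by (metis matrix_vector_mul_assoc)
  have "(transpose ?B *v v) $ j = 0" if "j \<notin> L" for j v
    using that by (simp add: matrix_vector_mult_def transpose_def restrict_columns_def)
  then show sub: "support x' \<subseteq> L" unfolding support_def x' by auto
  have "?B *v x' = ?B *v (?X *v (?B *v x))" by (simp add: x'_def restrict assms(1))
  also have "\<dots> = ?B *v x" by (metis P(1) matrix_vector_mul_assoc)
  finally show "\<Psi> *v x' = \<Psi> *v x" by (simp add: restrict sub assms(1))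
qed

text \<open>Once the support is found, the output has the same measurements as the signal and the same
  support, so injectivity on that support identifies them. What remains is a condition on
  finitely many comparisons of correlations, which also makes the event measurable.\<close>

lemma reconstructed_by_thresholding_iff:
  fixes \<Phi> :: "real^'k^'d" and A :: "real^'d^'n"
  shows "reconstructed_by_thresholding \<Phi> x A \<longleftrightarrow>
    thresholding_supports (A ** \<Phi>) (card (support x)) (A *v (\<Phi> *v x)) = {support x}"
proof
  assume "reconstructed_by_thresholding \<Phi> x A"
  then obtain x' where "thresholding (A ** \<Phi>) (card (support x)) (A *v (\<Phi> *v x)) = {(support x, x')}"
    by (auto simp: reconstructed_by_thresholding_def Let_def)
  then have "fst ` thresholding (A ** \<Phi>) (card (support x)) (A *v (\<Phi> *v x)) = {support x}" by simp
  then show "thresholding_supports (A ** \<Phi>) (card (support x)) (A *v (\<Phi> *v x)) = {support x}"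
    by (simp add: thresholding_def image_image)
next
  assume ts: "thresholding_supports (A ** \<Phi>) (card (support x)) (A *v (\<Phi> *v x)) = {support x}"
  define x' where "x' = pseudo_inverse (restrict_columns (support x) (A ** \<Phi>)) *v ((A ** \<Phi>) *v x)"
  have x': "support x' \<subseteq> support x" "(A ** \<Phi>) *v x' = (A ** \<Phi>) *v x"
    using pseudo_inverse_restrict_columns_recovers[of x "support x" "A ** \<Phi>"] by (simp_all add: x'_def)
  have "thresholding (A ** \<Phi>) (card (support x)) (A *v (\<Phi> *v x)) = {(support x, x')}"
    unfolding thresholding_def ts by (simp add: x'_def flip: matrix_vector_mul_assoc)
  moreover have "\<Phi> *v x' = \<Phi> *v x"
    if "inj_on (\<lambda>v. A *v v) ((\<lambda>z. \<Phi> *v z) ` {z. support z \<subseteq> support x})"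
    using x' by (intro inj_onD[OF that]) (auto simp: matrix_vector_mul_assoc)
  moreover have "x' = x" if "inj_on (\<lambda>z. (A ** \<Phi>) *v z) {z. support z \<subseteq> support x}"
    using x' by (intro inj_onD[OF that]) auto
  ultimately show "reconstructed_by_thresholding \<Phi> x A"
    unfolding reconstructed_by_thresholding_def Let_def by blast
qed

lemma column_matrix_mult: "column k (A ** \<Phi>) = A *v column k \<Phi>"
  for A :: "real^'d^'n" and \<Phi> :: "real^'k^'d"
  by (simp add: vec_eq_iff column_def matrix_matrix_mult_def matrix_vector_mult_def)

text \<open>The strict deviation bound also forces \<open>A y\<close> to be nonzero.\<close>

lemma separation_of_measured_correlations:
  fixes A :: "real^'d^'n" and \<Phi> :: "real^'k^'d" and y :: "real^'d"
  defines "w j \<equiv> column j \<Phi> - (y \<bullet> column j \<Phi>) *\<^sub>R y"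
  assumes dev: "\<And>j. \<bar>(A *v y) \<bullet> (A *v w j)\<bar> < \<delta> * (norm (A *v y))\<^sup>2"
    and gap: "\<bar>y \<bullet> column i \<Phi>\<bar> \<ge> \<bar>y \<bullet> column k \<Phi>\<bar> + 2 * \<delta>"
  shows "\<bar>(A *v y) \<bullet> column k (A ** \<Phi>)\<bar> < \<bar>(A *v y) \<bullet> column i (A ** \<Phi>)\<bar>"
proof -
  define \<rho> where "\<rho> = (norm (A *v y))\<^sup>2"
  have \<rho>: "\<rho> \<ge> 0" by (simp add: \<rho>_def)
  have corr: "(A *v y) \<bullet> column j (A ** \<Phi>) = (y \<bullet> column j \<Phi>) * \<rho> + (A *v y) \<bullet> (A *v w j)" for j
    by (simp add: column_matrix_mult w_def \<rho>_def matrix_vector_mult_diff_distrib matrix_vector_mult_scaleR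
        inner_diff_right power2_norm_eq_inner)
  have "\<bar>(A *v y) \<bullet> column k (A ** \<Phi>)\<bar> \<le> \<bar>y \<bullet> column k \<Phi>\<bar> * \<rho> + \<bar>(A *v y) \<bullet> (A *v w k)\<bar>"
    using \<rho> unfolding corr by (metis abs_mult abs_of_nonneg abs_triangle_ineq)
  also have "\<dots> < \<bar>y \<bullet> column k \<Phi>\<bar> * \<rho> + \<delta> * \<rho>" using dev[of k] by (simp add: \<rho>_def)
  also have "\<dots> \<le> \<bar>y \<bullet> column i \<Phi>\<bar> * \<rho> - \<delta> * \<rho>"
    using mult_right_mono[OF gap \<rho>] by (simp add: algebra_simps)
  also have "\<dots> < \<bar>y \<bullet> column i \<Phi>\<bar> * \<rho> - \<bar>(A *v y) \<bullet> (A *v w i)\<bar>" using dev[of i] by (simp add: \<rho>_def)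
  also have "\<dots> = \<bar>(y \<bullet> column i \<Phi>) * \<rho>\<bar> - \<bar>(A *v y) \<bullet> (A *v w i)\<bar>" using \<rho> by (simp add: abs_mult)
  also have "\<dots> \<le> \<bar>(A *v y) \<bullet> column i (A ** \<Phi>)\<bar>" unfolding corr by linarith
  finally show ?thesis .
qed

lemma residual_orthogonal:
  fixes y v :: "real^'d"
  assumes "norm y = 1" "norm v = 1"
  shows "y \<bullet> (v - (y \<bullet> v) *\<^sub>R y) = 0" and "norm (v - (y \<bullet> v) *\<^sub>R y) \<le> 1"
proof -
  have yy: "y \<bullet> y = 1" "v \<bullet> v = 1" using assms by (simp_all add: norm_eq_1)
  then show "y \<bullet> (v - (y \<bullet> v) *\<^sub>R y) = 0" by (simp add: inner_diff_right)
  have "(norm (v - (y \<bullet> v) *\<^sub>R y))\<^sup>2 = 1 - (y \<bullet> v)\<^sup>2"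
    unfolding power2_norm_eq_inner
    using yy by (simp add: inner_diff_left inner_diff_right inner_commute power2_eq_square)
  then have "(norm (v - (y \<bullet> v) *\<^sub>R y))\<^sup>2 \<le> 1\<^sup>2" by simp
  then show "norm (v - (y \<bullet> v) *\<^sub>R y) \<le> 1" by (rule power2_le_imp_le) simp
qed

text \<open>Multiplying the entries by the square root of \<open>n\<close> turns each row into independent standard Gaussian
  variables or signs, so that \<open>\<beta>\<close> for the normalised row corresponds to \<open>c = \<beta> n\<close> for the rows of \<open>A\<close>.\<close>

lemma (in prob_space) deviation_tail:
  fixes A :: "'a \<Rightarrow> real^'d^'n" and y w :: "real^'d"
  assumes random: "gaussian_matrix M A \<or> bernoulli_matrix M A"
    and y: "norm y = 1" and orth: "y \<bullet> w = 0" and w: "norm w \<le> 1"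
    and \<delta>: "0 < \<delta>" "\<delta> \<le> 1 / 2"
  shows "prob {\<omega> \<in> space M. \<delta> * (norm (A \<omega> *v y))\<^sup>2 \<le> (A \<omega> *v y) \<bullet> (A \<omega> *v w)}
    \<le> exp (- (tail_rate \<delta>) * real CARD('n))"
proof -
  define N where "N = real CARD('n)"
  have N: "0 < N" by (simp add: N_def)
  define \<beta> where "\<beta> = \<delta> / (1 + 3 * \<delta>)"
  define \<theta> where "\<theta> = tail_rate \<delta>"
  have \<beta>: "0 \<le> \<beta>" using \<delta> by (simp add: \<beta>_def)
  have ind: "indep_vars (\<lambda>_. borel) (\<lambda>(i, j) \<omega>. A \<omega> $ i $ j) UNIV"
    using random by (auto simp: gaussian_matrix_def bernoulli_matrix_def)
  define g where "g i j \<omega> = sqrt N * A \<omega> $ i $ j" for i j \<omega>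
  have indg: "indep_vars (\<lambda>_. borel) (g i) UNIV" for i
  proof -
    have "indep_vars (\<lambda>j. PiM {(i, j)} (\<lambda>_. borel))
        (\<lambda>j \<omega>. restrict (\<lambda>ij. (case ij of (i, j) \<Rightarrow> \<lambda>\<omega>. A \<omega> $ i $ j) \<omega>) {(i, j)}) UNIV"
      by (rule indep_vars_restrict[OF ind]) (auto simp: disjoint_family_on_def)
    then have "indep_vars (\<lambda>_. borel) (\<lambda>j \<omega>. sqrt N * (restrict (\<lambda>ij. (case ij of (i, j) \<Rightarrow> \<lambda>\<omega>. A \<omega> $ i $ j) \<omega>) {(i, j)}) (i, j)) UNIV"
      by (rule indep_vars_compose2) measurable
    then show ?thesis
      by (rule indep_vars_cong[THEN iffD1, rotated -1]) (auto simp: g_def)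
  qed
  have row: "(\<Sum>j\<in>UNIV. g i j \<omega> * v $ j) = sqrt N * (A \<omega> *v v) $ i" for i \<omega> v
    by (simp add: g_def matrix_vector_mult_def sum_distrib_left mult.assoc)
  have mgf: "(\<integral>\<^sup>+\<omega>. ennreal (exp (\<beta> * (\<Sum>j\<in>UNIV. g i j \<omega> * y $ j)
              * ((\<Sum>j\<in>UNIV. g i j \<omega> * w $ j) - \<delta> * (\<Sum>j\<in>UNIV. g i j \<omega> * y $ j)))) \<partial>M) \<le> ennreal (exp (- \<theta>))" for i
  proof (cases "gaussian_matrix M A")
    case True
    have law: "distributed M lborel (g i j) (\<lambda>u. ennreal (std_normal_density u))" for j
    proof -
      have "distributed M lborel (\<lambda>\<omega>. A \<omega> $ i $ j) (\<lambda>u. ennreal (normal_density 0 (1 / sqrt N) u))"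
        using True by (simp add: gaussian_matrix_def N_def)
      then have "distributed M lborel (\<lambda>\<omega>. 0 + sqrt N * A \<omega> $ i $ j)
         (\<lambda>u. ennreal (normal_density (0 + sqrt N * 0) (\<bar>sqrt N\<bar> * (1 / sqrt N)) u))"
        by (rule normal_density_affine) (use N in auto)
      then show ?thesis using N by (simp add: g_def[abs_def])
    qed
    show ?thesis
      using gaussian_row_mgf[OF indg law y orth w \<beta> gaussian_exponent(1)[OF \<delta>, folded \<beta>_def] less_imp_le[OF \<delta>(1)]]
        gaussian_exponent(2)[OF \<delta>, folded \<beta>_def \<theta>_def]
      by (meson ennreal_leI order_trans)
  next
    case False
    then have B: "bernoulli_matrix M A" using random by blast
    define b where "b = \<delta> * (71 / 100 + 32 / 100 * \<delta>) / (1 + 3 * \<delta>)"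
    have b: "0 \<le> b" using \<delta> by (simp add: b_def)
    have "g i j \<omega> = 1 \<longleftrightarrow> A \<omega> $ i $ j = 1 / sqrt N" "g i j \<omega> = - 1 \<longleftrightarrow> A \<omega> $ i $ j = - 1 / sqrt N" for j \<omega>
      using N by (auto simp: g_def field_simps)
    then have pm: "prob {\<omega> \<in> space M. g i j \<omega> = 1} = 1 / 2" "prob {\<omega> \<in> space M. g i j \<omega> = - 1} = 1 / 2" for j
      using B by (simp_all add: bernoulli_matrix_def N_def)
    note exponent = rademacher_exponent[OF \<delta>, folded \<beta>_def b_def \<theta>_def]
    show ?thesis
      using rademacher_row_mgf[OF indg pm y orth w b exponent(1,2)] exponent(3)
      by (meson ennreal_leI order_trans exp_le_cancel_iff[THEN iffD2])
  qed
  have "prob {\<omega> \<in> space M. \<delta> * (norm (A \<omega> *v y))\<^sup>2 \<le> (A \<omega> *v y) \<bullet> (A \<omega> *v w)} \<le> exp (- \<theta> * real CARD('n))"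
  proof (rule independent_rows_tail[OF ind])
    fix i
    have "(\<beta> * N) * (A \<omega> *v y) $ i * ((A \<omega> *v w) $ i - \<delta> * (A \<omega> *v y) $ i)
      = \<beta> * (\<Sum>j\<in>UNIV. g i j \<omega> * y $ j) * ((\<Sum>j\<in>UNIV. g i j \<omega> * w $ j) - \<delta> * (\<Sum>j\<in>UNIV. g i j \<omega> * y $ j))" for \<omega>
    proof -
      have "\<beta> * (r * r) * a * (c - \<delta> * a) = \<beta> * (r * a) * (r * c - \<delta> * (r * a))" for r a c
        by (simp add: algebra_simps)
      from this[of "sqrt N"] show ?thesis unfolding row using N by simp
    qed
    then show "(\<integral>\<^sup>+\<omega>. ennreal (exp ((\<beta> * N) * (A \<omega> *v y) $ i * ((A \<omega> *v w) $ i - \<delta> * (A \<omega> *v y) $ i))) \<partial>M)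
      \<le> ennreal (exp (- \<theta>))" using mgf[of i] by (simp only:)
  qed (use \<beta> N in simp)
  then show ?thesis by (simp add: \<theta>_def)
qed

section \<open>Probability of reconstruction\<close>

lemma measurable_reconstruction:
  fixes \<Phi> :: "real^'k^'d" and A :: "'w \<Rightarrow> real^'d^'n"
  assumes [measurable]: "\<And>i j. (\<lambda>\<omega>. A \<omega> $ i $ j) \<in> borel_measurable M"
  shows "{\<omega> \<in> space M. reconstructed_by_thresholding \<Phi> x (A \<omega>)} \<in> sets M"
proof -
  have [measurable]: "(\<lambda>\<omega>. (A \<omega> *v y) \<bullet> (A \<omega> *v v)) \<in> borel_measurable M" for y v
    by (simp add: matrix_vector_mult_def inner_vec_def)
  have "reconstructed_by_thresholding \<Phi> x (A \<omega>) \<longleftrightarrow>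
    (\<forall>L. (card L = card (support x) \<and>
       (\<forall>i\<in>L. \<forall>k\<in>-L. \<bar>(A \<omega> *v (\<Phi> *v x)) \<bullet> (A \<omega> *v column k \<Phi>)\<bar>
          \<le> \<bar>(A \<omega> *v (\<Phi> *v x)) \<bullet> (A \<omega> *v column i \<Phi>)\<bar>)) \<longleftrightarrow> L = support x)" for \<omega>
    unfolding reconstructed_by_thresholding_iff thresholding_supports_def column_matrix_mult
    by (simp add: set_eq_iff[where A = "Collect _"])
  then show ?thesis by simp
qed

lemma C_margin_eq:
  assumes "\<epsilon> > 0"
  shows "C_margin \<epsilon> = (C1 + C2 * (\<epsilon> / 2)) / (\<epsilon> / 2)\<^sup>2"
  using assms by (simp add: C_margin_def field_simps power2_eq_square)

lemma thresholding_margin_gap: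
  assumes margin: "thresholding_margin \<Phi> y L \<epsilon>" and i: "i \<in> L"
  shows "\<bar>y \<bullet> column i \<Phi>\<bar> > \<epsilon>" and "k \<notin> L \<Longrightarrow> \<bar>y \<bullet> column i \<Phi>\<bar> > \<bar>y \<bullet> column k \<Phi>\<bar> + \<epsilon>"
proof -
  let ?M = "Max (insert 0 ((\<lambda>k. \<bar>y \<bullet> column k \<Phi>\<bar>) ` (- L)))"
  have "Min ((\<lambda>i. \<bar>y \<bullet> column i \<Phi>\<bar>) ` L) \<le> \<bar>y \<bullet> column i \<Phi>\<bar>" using i by (intro Min_le) auto
  then have *: "\<bar>y \<bullet> column i \<Phi>\<bar> > ?M + \<epsilon>" using margin by (simp add: thresholding_margin_def)
  have "0 \<le> ?M" by (intro Max_ge) auto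
  then show "\<bar>y \<bullet> column i \<Phi>\<bar> > \<epsilon>" using * by linarith
  assume "k \<notin> L"
  then have "\<bar>y \<bullet> column k \<Phi>\<bar> \<le> ?M" by (intro Max_ge) auto
  then show "\<bar>y \<bullet> column i \<Phi>\<bar> > \<bar>y \<bullet> column k \<Phi>\<bar> + \<epsilon>" using * by linarith
qed

text \<open>The union bound over the \<open>2K\<close> deviation events, one for each atom and sign. Scaling \<open>w\<^sub>j\<close> by the sign
  makes both signs instances of \<open>deviation_tail\<close>.\<close>

lemma (in prob_space) reconstruction_failure_bound:
  fixes \<Phi> :: "real^'k^'d" and x :: "real^'k" and A :: "'a \<Rightarrow> real^'d^'n"
  assumes unit_atoms: "\<And>j. norm (column j \<Phi>) = 1" and y: "norm (\<Phi> *v x) = 1"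
    and random: "gaussian_matrix M A \<or> bernoulli_matrix M A"
    and \<delta>: "0 < \<delta>" "\<delta> \<le> 1 / 2"
    and gap: "\<And>i k. i \<in> support x \<Longrightarrow> k \<notin> support x \<Longrightarrow>
      \<bar>(\<Phi> *v x) \<bullet> column i \<Phi>\<bar> \<ge> \<bar>(\<Phi> *v x) \<bullet> column k \<Phi>\<bar> + 2 * \<delta>"
  shows "prob {\<omega> \<in> space M. reconstructed_by_thresholding \<Phi> x (A \<omega>)}
    \<ge> 1 - 2 * real CARD('k) * exp (- (tail_rate \<delta>) * real CARD('n))"
proof -
  define y where "y = \<Phi> *v x"
  define p where "p = exp (- (tail_rate \<delta>) * real CARD('n))"
  define w where "w j = column j \<Phi> - (y \<bullet> column j \<Phi>) *\<^sub>R y" for j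
  define bad where "bad js = {\<omega> \<in> space M. \<delta> * (norm (A \<omega> *v y))\<^sup>2 \<le> (A \<omega> *v y) \<bullet> (A \<omega> *v (snd js *\<^sub>R w (fst js)))}"
    for js :: "'k \<times> real"
  have ind: "indep_vars (\<lambda>_. borel) (\<lambda>(i, j) \<omega>. A \<omega> $ i $ j) UNIV"
    using random by (auto simp: gaussian_matrix_def bernoulli_matrix_def)
  have [measurable]: "(\<lambda>\<omega>. A \<omega> $ i $ j) \<in> borel_measurable M" for i j
    using ind by (auto simp: indep_vars_def dest!: bspec[of _ _ "(i, j)"])
  have [measurable]: "(\<lambda>\<omega>. (A \<omega> *v u) \<bullet> (A \<omega> *v v)) \<in> borel_measurable M" for u v
    by (simp add: matrix_vector_mult_def inner_vec_def)
  let ?E = "{\<omega> \<in> space M. reconstructed_by_thresholding \<Phi> x (A \<omega>)}"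
  have E: "?E \<in> events" by (rule measurable_reconstruction) measurable
  have bad_meas: "bad js \<in> events" for js
    unfolding bad_def power2_norm_eq_inner by measurable
  have bad_prob: "prob (bad js) \<le> p" if "js \<in> UNIV \<times> {1, -1}" for js
  proof -
    have s: "\<bar>snd js\<bar> = 1" using that by auto
    show ?thesis unfolding bad_def p_def
    proof (rule deviation_tail[OF random _ _ _ \<delta>])
      show "norm y = 1" using y by (simp add: y_def)
      then show "y \<bullet> (snd js *\<^sub>R w (fst js)) = 0" "norm (snd js *\<^sub>R w (fst js)) \<le> 1"
        using residual_orthogonal[OF _ unit_atoms] s by (simp_all add: w_def)
    qed
  qed
  have sub: "space M - ?E \<subseteq> (\<Union>js\<in>UNIV \<times> {1, -1}. bad js)"
  proof
    fix \<omega> assume \<omega>: "\<omega> \<in> space M - ?E"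
    show "\<omega> \<in> (\<Union>js\<in>UNIV \<times> {1, -1}. bad js)"
    proof (rule ccontr)
      assume "\<omega> \<notin> (\<Union>js\<in>UNIV \<times> {1, -1}. bad js)"
      then have nb: "\<not> \<delta> * (norm (A \<omega> *v y))\<^sup>2 \<le> (A \<omega> *v y) \<bullet> (A \<omega> *v (s *\<^sub>R w j))" if "s \<in> {1, -1}" for j s
        using \<omega> that by (auto simp: bad_def)
      have dev: "\<bar>(A \<omega> *v y) \<bullet> (A \<omega> *v w j)\<bar> < \<delta> * (norm (A \<omega> *v y))\<^sup>2" for j
        using nb[of 1 j] nb[of "-1" j, unfolded matrix_vector_mult_scaleR] by (simp add: abs_less_iff)
      have "reconstructed_by_thresholding \<Phi> x (A \<omega>)"
        unfolding reconstructed_by_thresholding_iff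
      proof (rule thresholding_supports_unique)
        fix i k assume "i \<in> support x" "k \<notin> support x"
        then show "\<bar>(A \<omega> *v (\<Phi> *v x)) \<bullet> column k (A \<omega> ** \<Phi>)\<bar> < \<bar>(A \<omega> *v (\<Phi> *v x)) \<bullet> column i (A \<omega> ** \<Phi>)\<bar>"
          by (intro separation_of_measured_correlations[where \<delta> = \<delta>] gap)
             (use dev in \<open>simp add: w_def y_def\<close>)
      qed
      then show False using \<omega> by simp
    qed
  qed
  have "1 - prob ?E = prob (space M - ?E)" using prob_compl[OF E] by simp
  also have "\<dots> \<le> prob (\<Union>js\<in>UNIV \<times> {1, -1}. bad js)"
    using sub bad_meas by (intro finite_measure_mono sets.finite_UN) auto
  also have "\<dots> \<le> (\<Sum>js\<in>UNIV \<times> {1, -1}. prob (bad js))"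
    using bad_meas by (intro finite_measure_subadditive_finite) auto
  also have "\<dots> \<le> (\<Sum>js\<in>(UNIV :: 'k set) \<times> {1, -1 :: real}. p)" by (intro sum_mono bad_prob)
  also have "\<dots> = 2 * real CARD('k) * p" by (simp add: card_cartesian_product)
  finally show ?thesis by (simp add: p_def)
qed

theorem theorem3p2:
  fixes \<Phi> :: "real^'k^'d"
    and x :: "real^'k"
    and y :: "real^'d"
    and \<epsilon> :: real
    and M :: "'w measure"
    and A :: "'w \<Rightarrow> real^'d^'n"
  assumes unit_atoms: "\<And>j. norm (column j \<Phi>) = 1"
    and signal: "y = \<Phi> *v x"
    and normalised: "norm y = 1"
    and eps_pos: "\<epsilon> > 0"
    and margin: "thresholding_margin \<Phi> y (support x) \<epsilon>"
    and prob: "prob_space M"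
    and random_matrix: "gaussian_matrix M A \<or> bernoulli_matrix M A"
  shows "(\<forall>t>0. real CARD('n) \<ge> C_margin \<epsilon> * (ln (2 * real CARD('k)) + t) \<longrightarrow>
             measure M {\<omega> \<in> space M. reconstructed_by_thresholding \<Phi> x (A \<omega>)} > 1 - exp (- t))
       \<and> C_margin \<epsilon> \<le> C3 / \<epsilon>\<^sup>2
       \<and> C3 \<le> 4 * C1 + 2 * C2
       \<and> 4 * C1 + 2 * C2 \<le> 17.71
       \<and> \<bar>C1 - 2.5044\<bar> < 0.00005
       \<and> \<bar>C2 - 3.8442\<bar> < 0.00005"
proof (intro conjI allI impI)
  interpret prob_space M by (fact prob)
  define \<delta> where "\<delta> = \<epsilon> / 2"
  have "support x \<noteq> {}"
  proof
    assume "support x = {}"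
    then have "x = 0" by (auto simp: support_def vec_eq_iff)
    then show False using normalised signal by simp
  qed
  \<comment> \<open>An index in the support has a correlation above \<open>\<epsilon>\<close>, and correlations of unit vectors are at
    most one. So \<open>\<epsilon> < 1\<close>, as needed for the exponents and for the bound on \<open>C(\<epsilon>)\<close>.\<close>
  then obtain i where i: "i \<in> support x" by blast
  have "\<bar>y \<bullet> column i \<Phi>\<bar> \<le> norm y * norm (column i \<Phi>)" by (rule Cauchy_Schwarz_ineq2)
  then have eps1: "\<epsilon> < 1"
    using thresholding_margin_gap(1)[OF margin i] normalised unit_atoms by simp
  then have \<delta>: "0 < \<delta>" "\<delta> \<le> 1 / 2" using eps_pos by (simp_all add: \<delta>_def)
  have C: "C_margin \<epsilon> = (C1 + C2 * \<delta>) / \<delta>\<^sup>2" using C_margin_eq[OF eps_pos] by (simp add: \<delta>_def)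
  define \<theta> where "\<theta> = tail_rate \<delta>"
  show "measure M {\<omega> \<in> space M. reconstructed_by_thresholding \<Phi> x (A \<omega>)} > 1 - exp (- t)"
    if t: "real CARD('n) \<ge> C_margin \<epsilon> * (ln (2 * real CARD('k)) + t)" for t
  proof -
    have cc: "2504 / 1000 + 3844 / 1000 * \<delta> < C1 + C2 * \<delta>"
      using C1_bounds C2_bounds \<delta> by (intro add_strict_mono mult_strict_right_mono) simp_all
    have c0: "0 < 2504 / 1000 + 3844 / 1000 * \<delta>" using \<delta> by simp
    have "0 < C_margin \<epsilon>" unfolding C using cc c0 \<delta> by simp
    then have "ln (2 * real CARD('k)) + t \<le> real CARD('n) / C_margin \<epsilon>"
      using t by (simp add: pos_le_divide_eq mult.commute)
    also have "\<dots> = real CARD('n) * (\<delta>\<^sup>2 / (C1 + C2 * \<delta>))" by (simp add: C)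
    also have "\<dots> < real CARD('n) * \<theta>"
      unfolding \<theta>_def using cc c0 \<delta> by (intro mult_strict_left_mono divide_strict_left_mono) auto
    finally have "exp (- \<theta> * real CARD('n)) < exp (- (ln (2 * real CARD('k)) + t))"
      by (simp add: mult.commute)
    also have "\<dots> = exp (- t - ln (2 * real CARD('k)))" by simp
    also have "\<dots> = exp (- t) / (2 * real CARD('k))" by (simp only: exp_diff) simp
    finally have "2 * real CARD('k) * exp (- \<theta> * real CARD('n)) < exp (- t)"
      by (simp add: pos_less_divide_eq mult.commute)
    moreover have "prob {\<omega> \<in> space M. reconstructed_by_thresholding \<Phi> x (A \<omega>)}
        \<ge> 1 - 2 * real CARD('k) * exp (- \<theta> * real CARD('n))"
      unfolding \<theta>_def
    proof (rule reconstruction_failure_bound[OF unit_atoms _ random_matrix \<delta>])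
      show "norm (\<Phi> *v x) = 1" using normalised signal by simp
    next
      fix i k assume "i \<in> support x" "k \<notin> support x"
      then show "\<bar>(\<Phi> *v x) \<bullet> column i \<Phi>\<bar> \<ge> \<bar>(\<Phi> *v x) \<bullet> column k \<Phi>\<bar> + 2 * \<delta>"
        using thresholding_margin_gap(2)[OF margin, of i k] by (simp add: \<delta>_def signal)
    qed
    ultimately show ?thesis by linarith
  qed
  have "2 * C2 / \<epsilon> \<le> 2 * C2 / \<epsilon>\<^sup>2"
    using C2_bounds eps_pos eps1 by (intro divide_left_mono) (auto simp: power2_eq_square mult_left_le)
  then show "C_margin \<epsilon> \<le> C3 / \<epsilon>\<^sup>2" by (simp add: C_margin_def C3_def add_divide_distrib)
  show "C3 \<le> 4 * C1 + 2 * C2" by (simp add: C3_def)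
  show "4 * C1 + 2 * C2 \<le> 17.71" "\<bar>C1 - 2.5044\<bar> < 0.00005" "\<bar>C2 - 3.8442\<bar> < 0.00005"
    unfolding abs_diff_less_iff using C1_bounds C2_bounds by simp_all
qed

end
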